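(* Let $G$ be a Lie group acting smoothly on an $m$-dimensional manifold $\mathcal M$, and let $\mu:G\times\mathcal M\to\mathbb R^\times$ be a smooth multiplier. Let $\widehat{\mathcal M}=\mathcal M\times\mathbb R^\times$, with points $\hat{\boldsymbol x}=(\boldsymbol x,x_{m+1})$, let $\pi:\widehat{\mathcal M}\to\mathcal M$, $\pi(\boldsymbol x,x_{m+1})=\boldsymbol x$, be the canonical projection, and consider the map $G\times\widehat{\mathcal M}\to\widehat{\mathcal M}$ given by $$g\cdot\hat{\boldsymbol x}=\bigl(g\cdot\boldsymbol x,\ x_{m+1}\,\mu(g,\boldsymbol x)\bigr).\qquad( * )$$ Then: (i) The map $( * )$ defines a smooth action of $G$ on $\widehat{\mathcal M}$. (ii) The projection $\pi$ is a $G$-equivariant map. (iii) If the action of $G$ on $\mathcal M$ is free and regular near a point $\boldsymbol x$, then the induced action of $G$ on $\widehat{\mathcal M}$ is also free and regular near any point in $\pi^{-1}(\boldsymbol x)$.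
   Context: $\mathbb R^\times=\mathbb R\setminus\{0\}$. A multiplier is a function $\mu:G\times\mathcal M\to\mathbb R^\times$ satisfying $\mu(gh,\boldsymbol x)=\mu(g,h\cdot\boldsymbol x)\,\mu(h,\boldsymbol x)$ and $\mu(e,\boldsymbol x)=1$ for all $g,h\in G$ and $\boldsymbol x\in\mathcal M$. An action is free if for each point the stabilizer $\{g\in G: g\cdot\boldsymbol x=\boldsymbol x\}$ is trivial. It is regular if all orbits have the same dimension and every point has arbitrarily small neighborhoods whose intersection with each orbit is a connected subset of that orbit. "Free and regular near a point" means that these conditions hold at the points of some neighborhood of that point. *)

theory Defs
  imports "HOL-Analysis.Analysis" "HOL-Algebra.Group_Action"
begin

section \<open>Smooth maps between subsets of Euclidean spaces\<close>

text \<open>\<open>k_times_cont_diff_on k S f\<close>: the map \<open>f\<close> is of class \<open>C^k\<close> on the open set \<open>S\<close>.\<close>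

primrec k_times_cont_diff_on ::
    "nat \<Rightarrow> 'a::real_normed_vector set \<Rightarrow> ('a \<Rightarrow> 'b::real_normed_vector) \<Rightarrow> bool" where
  "k_times_cont_diff_on 0 S f \<longleftrightarrow> continuous_on S f"
| "k_times_cont_diff_on (Suc k) S f \<longleftrightarrow>
     (\<forall>x\<in>S. f differentiable (at x)) \<and>
     (\<forall>v. k_times_cont_diff_on k S (\<lambda>x. frechet_derivative f (at x) v))"

text \<open>On an arbitrary set, smoothness means local extendability to a \<open>C^\<infinity>\<close> map on an open
  subset of the ambient space.  It is used below only for relatively open subsets of linear
  subspaces, where it agrees with being \<open>C^\<infinity>\<close> on that subspace.\<close>

definition smooth_on :: "'a::real_normed_vector set \<Rightarrow> ('a \<Rightarrow> 'b::real_normed_vector) \<Rightarrow> bool" where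
  "smooth_on A f \<longleftrightarrow>
     (\<forall>a\<in>A. \<exists>S g. open S \<and> a \<in> S \<and> (\<forall>k. k_times_cont_diff_on k S g) \<and> (\<forall>x\<in>A \<inter> S. f x = g x))"

section \<open>Smooth manifolds\<close>

text \<open>The model space is a linear subspace of a type of class \<^class>\<open>euclidean_space\<close> rather than
  the whole type: such types have dimension at least 1, whereas discrete Lie groups and
  zero-dimensional orbits need dimension 0.  It also lets the dimension vary within a formula.
  A chart is a pair of its domain and its coordinate map.\<close>

record ('a, 'e) mfd =
  mfd_top :: "'a topology"
  mfd_model :: "'e set"
  mfd_atlas :: "('a set \<times> ('a \<Rightarrow> 'e)) set"

abbreviation mfd_space :: "('a, 'e) mfd \<Rightarrow> 'a set" where
  "mfd_space M \<equiv> topspace (mfd_top M)"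

definition mfd_dim :: "('a, 'e::euclidean_space) mfd \<Rightarrow> nat" where
  "mfd_dim M = dim (mfd_model M)"

definition mfd_chart :: "'a topology \<Rightarrow> 'e::euclidean_space set \<Rightarrow> 'a set \<Rightarrow> ('a \<Rightarrow> 'e) \<Rightarrow> bool" where
  "mfd_chart X E U \<phi> \<longleftrightarrow>
     openin X U \<and> openin (top_of_set E) (\<phi> ` U) \<and>
     homeomorphic_map (subtopology X U) (top_of_set (\<phi> ` U)) \<phi>"

definition smooth_manifold :: "('a, 'e::euclidean_space) mfd \<Rightarrow> bool" where
  "smooth_manifold M \<longleftrightarrow>
     Hausdorff_space (mfd_top M) \<and> second_countable (mfd_top M) \<and> subspace (mfd_model M) \<and>
     (\<forall>(U, \<phi>)\<in>mfd_atlas M. mfd_chart (mfd_top M) (mfd_model M) U \<phi>) \<and>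
     (\<Union>(U, \<phi>)\<in>mfd_atlas M. U) = mfd_space M \<and>
     (\<forall>(U, \<phi>)\<in>mfd_atlas M. \<forall>(V, \<psi>)\<in>mfd_atlas M.
        smooth_on (\<phi> ` (U \<inter> V)) (\<psi> \<circ> inv_into U \<phi>))"

definition smooth_map ::
    "('a, 'e::euclidean_space) mfd \<Rightarrow> ('b, 'f::euclidean_space) mfd \<Rightarrow> ('a \<Rightarrow> 'b) \<Rightarrow> bool" where
  "smooth_map M N f \<longleftrightarrow>
     continuous_map (mfd_top M) (mfd_top N) f \<and>
     (\<forall>(U, \<phi>)\<in>mfd_atlas M. \<forall>(V, \<psi>)\<in>mfd_atlas N.
        smooth_on (\<phi> ` (U \<inter> f -` V)) (\<psi> \<circ> f \<circ> inv_into U \<phi>))"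

text \<open>The derivative within a relatively open subset of the model space is determined only on the
  model space, which is why injectivity is required there.\<close>

definition immersion ::
    "('a, 'e::euclidean_space) mfd \<Rightarrow> ('b, 'f::euclidean_space) mfd \<Rightarrow> ('a \<Rightarrow> 'b) \<Rightarrow> bool" where
  "immersion M N f \<longleftrightarrow>
     smooth_map M N f \<and>
     (\<forall>(U, \<phi>)\<in>mfd_atlas M. \<forall>(V, \<psi>)\<in>mfd_atlas N. \<forall>p\<in>U \<inter> f -` V.
        \<exists>D. ((\<psi> \<circ> f \<circ> inv_into U \<phi>) has_derivative D) (at (\<phi> p) within \<phi> ` (U \<inter> f -` V)) \<and>
            inj_on D (mfd_model M))"

definition prod_mfd ::
    "('a, 'e::euclidean_space) mfd \<Rightarrow> ('b, 'f::euclidean_space) mfd \<Rightarrow> ('a \<times> 'b, 'e \<times> 'f) mfd"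
    (infixr "\<times>\<^sub>m" 80) where
  "M \<times>\<^sub>m N =
     \<lparr>mfd_top = prod_topology (mfd_top M) (mfd_top N),
      mfd_model = mfd_model M \<times> mfd_model N,
      mfd_atlas = {(U \<times> V, map_prod \<phi> \<psi>) | U \<phi> V \<psi>.
        (U, \<phi>) \<in> mfd_atlas M \<and> (V, \<psi>) \<in> mfd_atlas N}\<rparr>"

definition nonzero_reals :: "(real, real) mfd" where
  "nonzero_reals =
     \<lparr>mfd_top = top_of_set (- {0}), mfd_model = UNIV, mfd_atlas = {(- {0}, \<lambda>x. x)}\<rparr>"

section \<open>Lie groups and their smooth actions\<close>

definition lie_group :: "('g, 'r) monoid_scheme \<Rightarrow> ('g, 'l::euclidean_space) mfd \<Rightarrow> bool" where
  "lie_group G L \<longleftrightarrow>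
     group G \<and> smooth_manifold L \<and> mfd_space L = carrier G \<and>
     smooth_map (L \<times>\<^sub>m L) L (\<lambda>(g, h). g \<otimes>\<^bsub>G\<^esub> h) \<and>
     smooth_map L L (\<lambda>g. inv\<^bsub>G\<^esub> g)"

definition smooth_action ::
    "('g, 'r) monoid_scheme \<Rightarrow> ('g, 'l::euclidean_space) mfd \<Rightarrow> ('m, 'e::euclidean_space) mfd \<Rightarrow>
     ('g \<Rightarrow> 'm \<Rightarrow> 'm) \<Rightarrow> bool" where
  "smooth_action G L M \<alpha> \<longleftrightarrow>
     lie_group G L \<and> smooth_manifold M \<and> group_action G (mfd_space M) \<alpha> \<and>
     smooth_map (L \<times>\<^sub>m M) M (\<lambda>(g, x). \<alpha> g x)"

definition multiplier ::
    "('g, 'r) monoid_scheme \<Rightarrow> 'm set \<Rightarrow> ('g \<Rightarrow> 'm \<Rightarrow> 'm) \<Rightarrow> ('g \<Rightarrow> 'm \<Rightarrow> real) \<Rightarrow> bool" where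
  "multiplier G X \<alpha> \<mu> \<longleftrightarrow>
     (\<forall>g\<in>carrier G. \<forall>x\<in>X. \<mu> g x \<noteq> 0) \<and>
     (\<forall>g\<in>carrier G. \<forall>h\<in>carrier G. \<forall>x\<in>X. \<mu> (g \<otimes>\<^bsub>G\<^esub> h) x = \<mu> g (\<alpha> h x) * \<mu> h x) \<and>
     (\<forall>x\<in>X. \<mu> \<one>\<^bsub>G\<^esub> x = 1)"

definition smooth_multiplier ::
    "('g, 'r) monoid_scheme \<Rightarrow> ('g, 'l::euclidean_space) mfd \<Rightarrow> ('m, 'e::euclidean_space) mfd \<Rightarrow>
     ('g \<Rightarrow> 'm \<Rightarrow> 'm) \<Rightarrow> ('g \<Rightarrow> 'm \<Rightarrow> real) \<Rightarrow> bool" where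
  "smooth_multiplier G L M \<alpha> \<mu> \<longleftrightarrow>
     multiplier G (mfd_space M) \<alpha> \<mu> \<and>
     smooth_map (L \<times>\<^sub>m M) nonzero_reals (\<lambda>(g, x). \<mu> g x)"

text \<open>The restriction in the definition of \<open>lift_action\<close> is there because \<^const>\<open>group_action\<close>
  requires the acting maps to be extensional.\<close>

definition lift_mfd :: "('m, 'e::euclidean_space) mfd \<Rightarrow> ('m \<times> real, 'e \<times> real) mfd" where
  "lift_mfd M = M \<times>\<^sub>m nonzero_reals"

definition lift_action ::
    "('m, 'e::euclidean_space) mfd \<Rightarrow> ('g \<Rightarrow> 'm \<Rightarrow> 'm) \<Rightarrow> ('g \<Rightarrow> 'm \<Rightarrow> real) \<Rightarrow>
     'g \<Rightarrow> 'm \<times> real \<Rightarrow> 'm \<times> real" where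
  "lift_action M \<alpha> \<mu> g = (\<lambda>(x, t)\<in>mfd_space (lift_mfd M). (\<alpha> g x, t * \<mu> g x))"

definition equivariant_map ::
    "('g, 'r) monoid_scheme \<Rightarrow> 'a set \<Rightarrow> ('g \<Rightarrow> 'a \<Rightarrow> 'a) \<Rightarrow> 'b set \<Rightarrow> ('g \<Rightarrow> 'b \<Rightarrow> 'b) \<Rightarrow>
     ('a \<Rightarrow> 'b) \<Rightarrow> bool" where
  "equivariant_map G X \<alpha> Y \<beta> f \<longleftrightarrow>
     f \<in> X \<rightarrow> Y \<and> (\<forall>g\<in>carrier G. \<forall>x\<in>X. f (\<alpha> g x) = \<beta> g (f x))"

section \<open>Free and regular actions\<close>

definition final_topology :: "'a topology \<Rightarrow> ('a \<Rightarrow> 'b) \<Rightarrow> 'b topology" where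
  "final_topology X f =
     topology (\<lambda>S. S \<subseteq> f ` topspace X \<and> openin X {x \<in> topspace X. f x \<in> S})"

lemma openin_final_topology:
  "openin (final_topology X f) S \<longleftrightarrow> S \<subseteq> f ` topspace X \<and> openin X {x \<in> topspace X. f x \<in> S}"
proof -
  have "istopology (\<lambda>S. S \<subseteq> f ` topspace X \<and> openin X {x \<in> topspace X. f x \<in> S})"
    unfolding istopology_def
  proof (intro conjI allI impI)
    fix S T
    assume "S \<subseteq> f ` topspace X \<and> openin X {x \<in> topspace X. f x \<in> S}"
      and "T \<subseteq> f ` topspace X \<and> openin X {x \<in> topspace X. f x \<in> T}"
    moreover have "{x \<in> topspace X. f x \<in> S \<inter> T} =
        {x \<in> topspace X. f x \<in> S} \<inter> {x \<in> topspace X. f x \<in> T}"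
      by blast
    ultimately show "S \<inter> T \<subseteq> f ` topspace X" "openin X {x \<in> topspace X. f x \<in> S \<inter> T}"
      by (auto simp: openin_Int)
  next
    fix K
    assume K: "\<forall>S\<in>K. S \<subseteq> f ` topspace X \<and> openin X {x \<in> topspace X. f x \<in> S}"
    then show "\<Union>K \<subseteq> f ` topspace X"
      by blast
    have "{x \<in> topspace X. f x \<in> \<Union>K} = (\<Union>S\<in>K. {x \<in> topspace X. f x \<in> S})"
      by blast
    with K show "openin X {x \<in> topspace X. f x \<in> \<Union>K}"
      by auto
  qed
  then show ?thesis
    by (simp add: final_topology_def)
qed

lemma quotient_map_final_topology: "quotient_map X (final_topology X f) f"
proof -
  have "{x \<in> topspace X. f x \<in> f ` topspace X} = topspace X"
    by blast
  then have "openin (final_topology X f) (f ` topspace X)"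
    by (simp add: openin_final_topology)
  then have "f ` topspace X \<subseteq> topspace (final_topology X f)"
    by (rule openin_subset)
  moreover have "topspace (final_topology X f) \<subseteq> f ` topspace X"
    using openin_final_topology[of X f "topspace (final_topology X f)"] openin_topspace by blast
  ultimately have "f ` topspace X = topspace (final_topology X f)"
    by (rule antisym)
  then show ?thesis
    unfolding quotient_map_def openin_final_topology by blast
qed

text \<open>An orbit carries the topology making it homeomorphic to the quotient of the group by a
  stabilizer; this is its topology as an immersed submanifold, in general finer than the subspace
  topology.\<close>

definition orbit_topology ::
    "('g, 'l::euclidean_space) mfd \<Rightarrow> ('g \<Rightarrow> 'm \<Rightarrow> 'm) \<Rightarrow> 'm \<Rightarrow> 'm topology" where
  "orbit_topology L \<alpha> x = final_topology (mfd_top L) (\<lambda>g. \<alpha> g x)"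

text \<open>The orbit through \<open>x\<close> is an immersed submanifold of dimension \<open>d\<close>.  Modelling the orbit on a
  subspace of the type used for the group loses nothing, as its dimension is at most that of the
  group.\<close>

definition has_orbit_dim ::
    "('g, 'l::euclidean_space) mfd \<Rightarrow> ('m, 'e::euclidean_space) mfd \<Rightarrow> ('g \<Rightarrow> 'm \<Rightarrow> 'm) \<Rightarrow>
     'm \<Rightarrow> nat \<Rightarrow> bool" where
  "has_orbit_dim L M \<alpha> x d \<longleftrightarrow>
     (\<exists>S :: ('m, 'l) mfd.
        smooth_manifold S \<and> mfd_top S = orbit_topology L \<alpha> x \<and> mfd_dim S = d \<and>
        immersion S M (\<lambda>y. y))"

definition free_on ::
    "('g, 'r) monoid_scheme \<Rightarrow> ('g \<Rightarrow> 'm \<Rightarrow> 'm) \<Rightarrow> 'm set \<Rightarrow> bool" where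
  "free_on G \<alpha> U \<longleftrightarrow> (\<forall>y\<in>U. stabilizer G \<alpha> y = {\<one>\<^bsub>G\<^esub>})"

definition regular_on ::
    "('g, 'r) monoid_scheme \<Rightarrow> ('g, 'l::euclidean_space) mfd \<Rightarrow> ('m, 'e::euclidean_space) mfd \<Rightarrow>
     ('g \<Rightarrow> 'm \<Rightarrow> 'm) \<Rightarrow> 'm set \<Rightarrow> bool" where
  "regular_on G L M \<alpha> U \<longleftrightarrow>
     (\<exists>d. \<forall>y\<in>U. has_orbit_dim L M \<alpha> y d) \<and>
     (\<forall>y\<in>U. \<forall>W. openin (mfd_top M) W \<and> y \<in> W \<longrightarrow>
        (\<exists>N. openin (mfd_top M) N \<and> y \<in> N \<and> N \<subseteq> W \<and>
           (\<forall>z\<in>mfd_space M. connectedin (orbit_topology L \<alpha> z) (N \<inter> orbit G \<alpha> z))))"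

definition free_and_regular_near ::
    "('g, 'r) monoid_scheme \<Rightarrow> ('g, 'l::euclidean_space) mfd \<Rightarrow> ('m, 'e::euclidean_space) mfd \<Rightarrow>
     ('g \<Rightarrow> 'm \<Rightarrow> 'm) \<Rightarrow> 'm \<Rightarrow> bool" where
  "free_and_regular_near G L M \<alpha> x \<longleftrightarrow>
     (\<exists>U. openin (mfd_top M) U \<and> x \<in> U \<and> free_on G \<alpha> U \<and> regular_on G L M \<alpha> U)"

end

theory Submission
  imports Defs
begin

text \<open>
  Parts (i) and (ii) are direct: the multiplier identities are the axioms of an action on the fibre
  coordinate, and in product charts the lifted action is built from the given smooth maps by pairing
  and multiplication (\<open>smooth_action_lift\<close>).

  Freeness in (iii) is inherited because a stabilizer of the lifted action is contained in the
  stabilizer of the point below.  Regularity has two halves, and they need different arguments.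

  Orbit dimension.  The orbit map of a point with trivial stabilizer is injective, and by
  equivariance the kernels of its derivatives have the same dimension at all group elements
  (\<open>dim_kernel_orbit_map_le\<close>).  An injective map of constant rank is an immersion; this follows from
  the inverse function theorem (\<open>injective_imp_injective_derivative\<close>).  So every orbit with trivial
  stabilizer, below or in the lift, is an immersed copy of the group (\<open>has_orbit_dim_free\<close>), and the
  common dimension is that of the group.

  Neighbourhoods.  Regularity and freeness below make return times small: for suitable
  neighbourhoods \<open>N\<close> of a point, an element taking some point of \<open>N\<close> back to \<open>N\<close> is close to the
  identity (\<open>small_return_times\<close>).  Given a small open set \<open>J\<close> of fibre coordinates, the points above
  \<open>N\<close> whose lifted orbit meets \<open>N \<times> J\<close> form an open set that is still small, by continuity of the
  lifted action at the identity.  It contains either nothing of a lifted orbit or all of the part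
  above \<open>N\<close>, so its intersections with orbits are connected because those of \<open>N\<close> are
  (\<open>lift_regular_neighbourhood\<close>).
\<close>

section \<open>Calculus of differentiable functions\<close>

lemma frechet_derivative_cong_open:
  assumes "open S" "x \<in> S" "\<And>y. y \<in> S \<Longrightarrow> f y = g y"
  shows "f differentiable (at x) \<longleftrightarrow> g differentiable (at x)"
    and "frechet_derivative f (at x) = frechet_derivative g (at x)"
proof -
  have *: "(f has_derivative D) (at x) \<longleftrightarrow> (g has_derivative D) (at x)" for D
    using assms has_derivative_transform_within_open[of f D x UNIV S g]
      has_derivative_transform_within_open[of g D x UNIV S f] by auto
  then show "f differentiable (at x) \<longleftrightarrow> g differentiable (at x)"
    by (simp add: differentiable_def)
  show "frechet_derivative f (at x) = frechet_derivative g (at x)"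
    by (simp add: frechet_derivative_def *)
qed

lemma k_times_cont_diff_on_cong:
  assumes "open S" "k_times_cont_diff_on k S f" "\<And>x. x \<in> S \<Longrightarrow> f x = g x"
  shows "k_times_cont_diff_on k S g"
  using assms(2,3)
proof (induction k arbitrary: f g)
  case 0
  then show ?case
    by (simp cong: continuous_on_cong)
next
  case (Suc k)
  have "frechet_derivative f (at x) v = frechet_derivative g (at x) v" if "x \<in> S" for x v
    using frechet_derivative_cong_open(2)[where f=f and g=g, OF assms(1) that Suc.prems(2)] by simp
  moreover have "k_times_cont_diff_on k S (\<lambda>x. frechet_derivative f (at x) v)" for v
    using Suc.prems(1) by simp
  ultimately have *: "k_times_cont_diff_on k S (\<lambda>x. frechet_derivative g (at x) v)" for v
    using Suc.IH[of "\<lambda>x. frechet_derivative f (at x) v" "\<lambda>x. frechet_derivative g (at x) v"]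
    by presburger
  have "g differentiable (at x)" if "x \<in> S" for x
    using Suc.prems(1) frechet_derivative_cong_open(1)[where f=f and g=g, OF assms(1) that Suc.prems(2)] that by simp
  with * show ?case
    by simp
qed

lemma k_times_cont_diff_on_subset:
  assumes "k_times_cont_diff_on k S f" "T \<subseteq> S"
  shows "k_times_cont_diff_on k T f"
  using assms by (induction k arbitrary: f) (auto intro: continuous_on_subset)

lemma k_times_cont_diff_on_Suc_imp:
  "k_times_cont_diff_on (Suc k) S f \<Longrightarrow> k_times_cont_diff_on k S f"
proof (induction k arbitrary: f)
  case 0
  then show ?case
    by (simp add: continuous_at_imp_continuous_on differentiable_imp_continuous_within)
next
  case (Suc k)
  have "k_times_cont_diff_on k S (\<lambda>x. frechet_derivative f (at x) v)" for v
    using Suc.prems by (intro Suc.IH) simp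
  then show ?case
    using Suc.prems by simp
qed

text \<open>The recursive definition is easiest to use when the derivative is known in closed form.\<close>

lemma k_times_cont_diff_on_SucI:
  assumes "open S" "\<And>x. x \<in> S \<Longrightarrow> (f has_derivative D x) (at x)"
    and "\<And>v. k_times_cont_diff_on k S (\<lambda>x. D x v)"
  shows "k_times_cont_diff_on (Suc k) S f"
proof -
  have "D x v = frechet_derivative f (at x) v" if "x \<in> S" for x v
    using frechet_derivative_at[OF assms(2)[OF that]] by simp
  then have "k_times_cont_diff_on k S (\<lambda>x. frechet_derivative f (at x) v)" for v
    by (rule k_times_cont_diff_on_cong[OF assms(1) assms(3)])
  then show ?thesis
    using assms(2) by (auto simp: differentiable_def)
qed

lemma k_times_cont_diff_on_has_derivative:
  assumes "k_times_cont_diff_on (Suc k) S f" "x \<in> S"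
  shows "(f has_derivative frechet_derivative f (at x)) (at x)"
proof -
  have "f differentiable (at x)"
    using assms by simp
  then show ?thesis
    by (rule iffD1[OF frechet_derivative_works])
qed

lemma k_times_cont_diff_on_const: "open S \<Longrightarrow> k_times_cont_diff_on k S (\<lambda>x. c)"
proof (induction k arbitrary: c)
  case 0
  then show ?case
    by simp
next
  case (Suc k)
  show ?case
    by (rule k_times_cont_diff_on_SucI[where D="\<lambda>x v. 0"]) (rule Suc has_derivative_const)+
qed

lemma k_times_cont_diff_on_bounded_linear:
  assumes "open S" "bounded_linear f"
  shows "k_times_cont_diff_on k S f"
proof (cases k)
  case 0
  then show ?thesis
    using assms by (simp add: linear_continuous_on)
next
  case (Suc j)
  show ?thesis
    unfolding Suc
    by (rule k_times_cont_diff_on_SucI[where D="\<lambda>x. f"])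
      (rule assms bounded_linear_imp_has_derivative k_times_cont_diff_on_const)+
qed

lemma k_times_cont_diff_on_Pair:
  assumes "open S" "k_times_cont_diff_on k S f" "k_times_cont_diff_on k S g"
  shows "k_times_cont_diff_on k S (\<lambda>x. (f x, g x))"
  using assms(2,3)
proof (induction k arbitrary: f g)
  case 0
  then show ?case
    by (simp add: continuous_on_Pair)
next
  case (Suc k)
  show ?case
  proof (rule k_times_cont_diff_on_SucI[where
        D="\<lambda>x v. (frechet_derivative f (at x) v, frechet_derivative g (at x) v)",
        OF assms(1) has_derivative_Pair])
    fix v
    show "k_times_cont_diff_on k S (\<lambda>x. (frechet_derivative f (at x) v, frechet_derivative g (at x) v))"
      using Suc.prems by (intro Suc.IH) auto
  qed (use Suc.prems k_times_cont_diff_on_has_derivative in blast)+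
qed

lemma k_times_cont_diff_on_add:
  assumes "open S" "k_times_cont_diff_on k S f" "k_times_cont_diff_on k S g"
  shows "k_times_cont_diff_on k S (\<lambda>x. f x + g x)"
  using assms(2,3)
proof (induction k arbitrary: f g)
  case 0
  then show ?case
    by (simp add: continuous_on_add)
next
  case (Suc k)
  show ?case
  proof (rule k_times_cont_diff_on_SucI[where
        D="\<lambda>x v. frechet_derivative f (at x) v + frechet_derivative g (at x) v",
        OF assms(1) has_derivative_add])
    fix v
    show "k_times_cont_diff_on k S (\<lambda>x. frechet_derivative f (at x) v + frechet_derivative g (at x) v)"
      using Suc.prems by (intro Suc.IH) auto
  qed (use Suc.prems k_times_cont_diff_on_has_derivative in blast)+
qed

text \<open>The product rule contains the undifferentiated factors, so the induction has to weaken
  \<open>C^(k+1)\<close> to \<open>C^k\<close> for them.\<close>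

lemma k_times_cont_diff_on_mult:
  fixes f g :: "'a::real_normed_vector \<Rightarrow> 'b::real_normed_algebra"
  assumes "open S" "k_times_cont_diff_on k S f" "k_times_cont_diff_on k S g"
  shows "k_times_cont_diff_on k S (\<lambda>x. f x * g x)"
  using assms(2,3)
proof (induction k arbitrary: f g)
  case 0
  then show ?case
    by (simp add: continuous_on_mult)
next
  case (Suc k)
  show ?case
  proof (rule k_times_cont_diff_on_SucI[where
        D="\<lambda>x v. f x * frechet_derivative g (at x) v + frechet_derivative f (at x) v * g x",
        OF assms(1) has_derivative_mult])
    fix v
    show "k_times_cont_diff_on k S
        (\<lambda>x. f x * frechet_derivative g (at x) v + frechet_derivative f (at x) v * g x)"
      using Suc.prems
      by (intro k_times_cont_diff_on_add[OF assms(1)] Suc.IH;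
          auto simp del: k_times_cont_diff_on.simps(2)
            intro: k_times_cont_diff_on_Suc_imp[OF Suc.prems(1)] k_times_cont_diff_on_Suc_imp[OF Suc.prems(2)])
        (simp_all)
  qed (use Suc.prems k_times_cont_diff_on_has_derivative in blast)+
qed

lemma k_times_cont_diff_on_compose_affine:
  assumes "open T" "bounded_linear l" "\<And>x. x \<in> T \<Longrightarrow> c + l x \<in> S" "k_times_cont_diff_on k S f"
  shows "k_times_cont_diff_on k T (\<lambda>x. f (c + l x))"
  using assms(4)
proof (induction k arbitrary: f)
  case 0
  have "continuous_on T (\<lambda>x. c + l x)"
    using assms(2) by (intro continuous_intros linear_continuous_on)
  then show ?case
    using 0 assms(3) by (auto intro: continuous_on_compose2)
next
  case (Suc k)
  show ?case
  proof (rule k_times_cont_diff_on_SucI[OF assms(1)])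
    fix x assume "x \<in> T"
    moreover have "((\<lambda>x. c + l x) has_derivative l) (at x)"
      using assms(2) by (auto intro!: derivative_eq_intros bounded_linear_imp_has_derivative)
    ultimately show "((\<lambda>x. f (c + l x)) has_derivative
        (\<lambda>v. frechet_derivative f (at (c + l x)) (l v))) (at x)"
      using has_derivative_compose[of "\<lambda>x. c + l x" l x UNIV f]
        k_times_cont_diff_on_has_derivative[OF Suc.prems] assms(3) by blast
  next
    fix v
    show "k_times_cont_diff_on k T (\<lambda>x. frechet_derivative f (at (c + l x)) (l v))"
      using Suc.prems by (intro Suc.IH) auto
  qed
qed

section \<open>Smooth functions on arbitrary sets\<close>

lemma smooth_onE:
  assumes "smooth_on A f" "a \<in> A"
  obtains S g where "open S" "a \<in> S" "\<forall>k. k_times_cont_diff_on k S g"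
    "\<forall>x\<in>A \<inter> S. f x = g x"
  using assms unfolding smooth_on_def by blast

lemma smooth_on_cong:
  assumes "smooth_on A f" "\<And>x. x \<in> A \<Longrightarrow> f x = g x"
  shows "smooth_on A g"
  unfolding smooth_on_def
proof
  fix a assume a: "a \<in> A"
  from assms(1) a obtain S h where "open S" "a \<in> S" "\<forall>k. k_times_cont_diff_on k S h"
    "\<forall>x\<in>A \<inter> S. f x = h x"
    by (rule smooth_onE) blast
  with assms(2) show "\<exists>S h. open S \<and> a \<in> S \<and> (\<forall>k. k_times_cont_diff_on k S h) \<and> (\<forall>x\<in>A \<inter> S. g x = h x)"
    by (intro exI[of _ S] exI[of _ h]) auto
qed

lemma smooth_on_has_derivative:
  assumes "smooth_on A f" "a \<in> A"
  obtains D where "(f has_derivative D) (at a within A)"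
proof -
  obtain S g where g: "open S" "a \<in> S" "\<forall>k. k_times_cont_diff_on k S g"
    "\<forall>x\<in>A \<inter> S. f x = g x"
    using assms by (rule smooth_onE) blast
  have "(g has_derivative frechet_derivative g (at a)) (at a within A)"
    using k_times_cont_diff_on_has_derivative g(2,3) has_derivative_at_withinI by blast
  moreover have "\<forall>\<^sub>F x in at a within A. g x = f x"
    using g(1,2,4) by (auto simp: eventually_at_topological)
  ultimately have "(f has_derivative frechet_derivative g (at a)) (at a within A)"
    using g(2,4) assms(2) by (simp add: has_derivative_transform_eventually)
  then show thesis ..
qed

lemma smooth_on_bounded_linear: "bounded_linear f \<Longrightarrow> smooth_on A f"
  unfolding smooth_on_def
  by (intro ballI exI[of _ UNIV] exI[of _ f]) (auto intro: k_times_cont_diff_on_bounded_linear)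

lemma smooth_on_compose_affine:
  assumes "smooth_on B f" "bounded_linear l" "\<And>x. x \<in> A \<Longrightarrow> c + l x \<in> B"
  shows "smooth_on A (\<lambda>x. f (c + l x))"
  unfolding smooth_on_def
proof
  fix a assume "a \<in> A"
  with assms(1) have "smooth_on B f" "c + l a \<in> B"
    using assms(3) by auto
  then obtain S g where g: "open S" "c + l a \<in> S" "\<forall>k. k_times_cont_diff_on k S g"
    "\<forall>x\<in>B \<inter> S. f x = g x"
    by (rule smooth_onE) blast
  have "continuous_on UNIV (\<lambda>x. c + l x)"
    using assms(2) by (intro continuous_intros linear_continuous_on)
  then have op: "open ((\<lambda>x. c + l x) -` S)"
    using g(1) by (simp add: continuous_on_open_vimage)
  have "k_times_cont_diff_on k ((\<lambda>x. c + l x) -` S) (\<lambda>x. g (c + l x))" for k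
    using op assms(2) g(3) by (intro k_times_cont_diff_on_compose_affine) auto
  with op show "\<exists>S g. open S \<and> a \<in> S \<and> (\<forall>k. k_times_cont_diff_on k S g) \<and> (\<forall>x\<in>A \<inter> S. f (c + l x) = g x)"
    using g(2,4) assms(3)
    by (intro exI[of _ "(\<lambda>x. c + l x) -` S"] exI[of _ "\<lambda>x. g (c + l x)"]) auto
qed

lemma smooth_on_Pair:
  assumes "smooth_on A f" "smooth_on A g"
  shows "smooth_on A (\<lambda>x. (f x, g x))"
  unfolding smooth_on_def
proof
  fix a assume a: "a \<in> A"
  obtain S f' where f: "open S" "a \<in> S" "\<forall>k. k_times_cont_diff_on k S f'"
    "\<forall>x\<in>A \<inter> S. f x = f' x"
    using assms(1) a by (rule smooth_onE) blast
  obtain T g' where g: "open T" "a \<in> T" "\<forall>k. k_times_cont_diff_on k T g'"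
    "\<forall>x\<in>A \<inter> T. g x = g' x"
    using assms(2) a by (rule smooth_onE) blast
  have "k_times_cont_diff_on k (S \<inter> T) (\<lambda>x. (f' x, g' x))" for k
    using f g by (intro k_times_cont_diff_on_Pair)
      (auto intro: k_times_cont_diff_on_subset[of k S] k_times_cont_diff_on_subset[of k T])
  then show "\<exists>S h. open S \<and> a \<in> S \<and> (\<forall>k. k_times_cont_diff_on k S h) \<and> (\<forall>x\<in>A \<inter> S. (f x, g x) = h x)"
    using f g by (intro exI[of _ "S \<inter> T"] exI[of _ "\<lambda>x. (f' x, g' x)"]) auto
qed

lemma smooth_on_mult:
  fixes f g :: "'a::real_normed_vector \<Rightarrow> 'b::real_normed_algebra"
  assumes "smooth_on A f" "smooth_on A g"
  shows "smooth_on A (\<lambda>x. f x * g x)"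
  unfolding smooth_on_def
proof
  fix a assume a: "a \<in> A"
  obtain S f' where f: "open S" "a \<in> S" "\<forall>k. k_times_cont_diff_on k S f'"
    "\<forall>x\<in>A \<inter> S. f x = f' x"
    using assms(1) a by (rule smooth_onE) blast
  obtain T g' where g: "open T" "a \<in> T" "\<forall>k. k_times_cont_diff_on k T g'"
    "\<forall>x\<in>A \<inter> T. g x = g' x"
    using assms(2) a by (rule smooth_onE) blast
  have "k_times_cont_diff_on k (S \<inter> T) (\<lambda>x. f' x * g' x)" for k
    using f g by (intro k_times_cont_diff_on_mult)
      (auto intro: k_times_cont_diff_on_subset[of k S] k_times_cont_diff_on_subset[of k T])
  then show "\<exists>S h. open S \<and> a \<in> S \<and> (\<forall>k. k_times_cont_diff_on k S h) \<and> (\<forall>x\<in>A \<inter> S. f x * g x = h x)"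
    using f g by (intro exI[of _ "S \<inter> T"] exI[of _ "\<lambda>x. f' x * g' x"]) auto
qed

section \<open>Derivatives relative to a linear subspace\<close>

lemma subspace_projection:
  fixes E :: "'a::euclidean_space set"
  assumes "subspace E"
  obtains p where "linear p" "range p \<subseteq> E" "\<And>x. x \<in> E \<Longrightarrow> p x = x"
  using linear_exists_left_inverse_on[of id E] assms by (auto simp: linear_id)

text \<open>Composing with a linear projection onto the subspace turns a derivative within a relatively
  open set into one at a point, and the latter is unique.\<close>

lemma has_derivative_unique_on_subspace:
  fixes E :: "'a::euclidean_space set"
  assumes E: "subspace E" and A: "openin (top_of_set E) A" and "a \<in> A"
    and D: "(f has_derivative D) (at a within A)" and D': "(f has_derivative D') (at a within A)"
    and "v \<in> E"
  shows "D v = D' v"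
proof -
  obtain p where p: "linear p" "range p \<subseteq> E" "\<And>x. x \<in> E \<Longrightarrow> p x = x"
    using subspace_projection[OF E] by blast
  obtain T where T: "open T" "A = E \<inter> T"
    using A by (auto simp: openin_open)
  have "a \<in> E"
    using T \<open>a \<in> A\<close> by auto
  have "continuous_on UNIV p"
    using p(1) linear_continuous_on linear_conv_bounded_linear by blast
  moreover have "p -` A = p -` T"
    using p(2) T by auto
  ultimately have op: "open (p -` A)"
    using T(1) by (simp add: continuous_on_open_vimage)
  have *: "(f \<circ> p has_derivative F \<circ> p) (at a)" if "(f has_derivative F) (at a within A)" for F
  proof -
    have "(p has_derivative p) (at a within p -` A)"
      using p(1) by (rule linear_imp_has_derivative)
    moreover have "(f has_derivative F) (at (p a) within p ` (p -` A))"
      using that p(3) \<open>a \<in> E\<close> has_derivative_subset[of f F a A "p ` (p -` A)"] by auto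
    ultimately have "(f \<circ> p has_derivative F \<circ> p) (at a within p -` A)"
      by (rule diff_chain_within)
    then show ?thesis
      using op \<open>a \<in> A\<close> p(3)[OF \<open>a \<in> E\<close>] by (metis at_within_open vimageI)
  qed
  have "D \<circ> p = D' \<circ> p"
    using *[OF D] *[OF D'] by (rule has_derivative_unique)
  then show ?thesis
    using p(3)[OF \<open>v \<in> E\<close>] by (metis comp_apply)
qed

section \<open>Injective maps whose derivative has minimal kernel\<close>

text \<open>A pointwise form of the fact that an injective map of constant rank is an immersion.  Let \<open>K\<close> be the kernel of the
  derivative at \<open>a\<close> and \<open>p\<close> a projection onto \<open>K\<close>.  Composing \<open>f\<close> with a left inverse \<open>q\<close> of the
  derivative on the complement of \<open>K\<close> and adding \<open>p\<close> gives a map \<open>\<Phi>\<close> with derivative the identity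
  at \<open>a\<close>, hence a local diffeomorphism.  The curves on which \<open>\<Phi>\<close> moves in a fixed direction of \<open>K\<close>
  have velocities killed by the derivative of \<open>q \<circ> f\<close>.  The kernel of that derivative has at most
  the dimension of \<open>K\<close>, because \<open>p\<close> is injective on it; since the kernel of \<open>f'\<close> does not get
  smaller, the two coincide.  So \<open>f\<close> is constant on such a curve, which contradicts injectivity
  unless \<open>K\<close> is trivial.\<close>

lemma injective_imp_injective_derivative:
  fixes f :: "'a::euclidean_space \<Rightarrow> 'b::euclidean_space" and f' :: "'a \<Rightarrow> 'a \<Rightarrow>\<^sub>L 'b"
  assumes W: "open W" "a \<in> W" and inj: "inj_on f W"
    and der: "\<And>x. x \<in> W \<Longrightarrow> (f has_derivative f' x) (at x)"
    and cont: "continuous_on W f'"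
    and rank: "\<And>x. x \<in> W \<Longrightarrow> dim {v. f' a v = 0} \<le> dim {v. f' x v = 0}"
    and v: "f' a v = 0"
  shows "v = 0"
proof -
  define K where "K = {v. f' a v = 0}"
  have K: "subspace K"
    unfolding K_def by (intro linear_subspace_kernel bounded_linear.linear blinfun.bounded_linear_right)
  obtain p where p: "linear p" "range p \<subseteq> K" "\<And>x. x \<in> K \<Longrightarrow> p x = x"
    using subspace_projection[OF K] by blast
  define C where "C = {v. p v = 0}"
  have C: "subspace C"
    unfolding C_def using p(1) by (rule linear_subspace_kernel)
  have "inj_on (f' a) C"
    unfolding linear_inj_on_iff_eq_0[OF bounded_linear.linear[OF blinfun.bounded_linear_right] C]
    using p(3) by (auto simp: C_def K_def)
  then obtain q where q: "range q \<subseteq> C" "linear q" "\<And>v. v \<in> C \<Longrightarrow> q (f' a v) = v"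
    using linear_exists_left_inverse_on[OF bounded_linear.linear[OF blinfun.bounded_linear_right] C]
    by blast
  have bl: "bounded_linear p" "bounded_linear q"
    using p(1) q(2) linear_conv_bounded_linear by blast+
  have p0: "p (q y) = 0" for y
    using q(1) by (auto simp: C_def)
  define \<Phi> where "\<Phi> x = q (f x) + p x" for x
  define \<Phi>' where "\<Phi>' x = (Blinfun q o\<^sub>L f' x) + Blinfun p" for x
  have \<Phi>'[simp]: "\<Phi>' x u = q (f' x u) + p u" for x u
    using bl by (simp add: \<Phi>'_def blinfun.bilinear_simps bounded_linear_Blinfun_apply)
  have "q (f' a u) + p u = u" for u
  proof -
    have "p (p u) = p u"
      using p by blast
    then have "u - p u \<in> C"
      using p(1) by (simp add: C_def linear_diff)
    then have "q (f' a (u - p u)) = u - p u"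
      by (rule q(3))
    moreover have "f' a (p u) = 0"
      using p(2) by (auto simp: K_def)
    ultimately show ?thesis
      by (simp add: blinfun.diff_right)
  qed
  then have "\<Phi>' a = id_blinfun"
    by (intro blinfun_eqI) simp
  then have inv: "id_blinfun o\<^sub>L \<Phi>' a = id_blinfun"
    by (intro blinfun_eqI) simp
  have der\<Phi>: "(\<Phi> has_derivative \<Phi>' x) (at x)" if "x \<in> W" for x
  proof -
    have "((\<lambda>x. q (f x) + p x) has_derivative (\<lambda>u. q (f' x u) + p u)) (at x)"
      by (rule has_derivative_add[OF bounded_linear.has_derivative[OF bl(2) der[OF that]]
            bounded_linear_imp_has_derivative[OF bl(1)]])
    moreover have "blinfun_apply (\<Phi>' x) = (\<lambda>u. q (f' x u) + p u)"
      by auto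
    ultimately show ?thesis
      unfolding \<Phi>_def by simp
  qed
  have cont\<Phi>: "continuous_on W \<Phi>'"
    unfolding \<Phi>'_def using cont by (intro continuous_intros)
  obtain U V g g' where U: "open U" "U \<subseteq> W" "a \<in> U" and V: "open V" "\<Phi> a \<in> V"
    and hom: "homeomorphism U V \<Phi> g"
    and g: "\<And>y. y \<in> V \<Longrightarrow> (g has_derivative g' y) (at y)"
      "\<And>y. y \<in> V \<Longrightarrow> g' y = inv_into UNIV (\<Phi>' (g y))" "\<And>y. y \<in> V \<Longrightarrow> bij (\<Phi>' (g y))"
    using inverse_function_theorem[OF W(1) der\<Phi> cont\<Phi> W(2) inv] by metis
  have gU: "g y \<in> U" if "y \<in> V" for y
    using hom that by (auto simp: homeomorphism_def)
  \<comment> \<open>The directions along which \<open>\<Phi>\<close> moves inside \<open>K\<close> are killed by \<open>f'\<close>, at every nearby point.\<close>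
  have ker: "f' (g y) (g' y k) = 0" if "y \<in> V" "k \<in> K" for y k
  proof -
    let ?x = "g y"
    have x: "?x \<in> W"
      using gU that(1) U(2) by blast
    have \<Phi>k: "q (f' ?x (g' y k)) + p (g' y k) = k"
      using g(2,3)[OF that(1)] by (metis \<Phi>' bij_inv_eq_iff)
    then have "p k = p (p (g' y k))"
      by (metis p0 p(1) linear_add add_0)
    then have "k = p (g' y k)"
      using p that(2) by (metis rangeI subsetD)
    with \<Phi>k have q0: "q (f' ?x (g' y k)) = 0"
      by simp
    let ?K = "{u. f' ?x u = 0}" and ?Q = "{u. q (f' ?x u) = 0}"
    have lin: "linear (f' ?x)" "linear (\<lambda>u. q (f' ?x u))"
      using linear_compose[OF _ q(2), of "f' ?x"] bounded_linear.linear[OF blinfun.bounded_linear_right]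
      by (auto simp: o_def)
    have "inj_on p ?Q"
    proof (rule inj_onI)
      fix u w assume "u \<in> ?Q" "w \<in> ?Q" "p u = p w"
      then have "\<Phi>' ?x u = \<Phi>' ?x w"
        by simp
      then show "u = w"
        using g(3)[OF that(1)] by (metis bij_is_inj injD)
    qed
    then have "dim ?Q = dim (p ` ?Q)"
      using dim_image_eq[OF p(1), of ?Q] span_eq_iff[of ?Q] linear_subspace_kernel[OF lin(2)] by metis
    also have "\<dots> \<le> dim K"
      using p(2) by (intro dim_subset) auto
    \<comment> \<open>Kernels do not shrink near \<open>a\<close>; with the trivial inclusion this forces equality.\<close>
    also have "\<dots> \<le> dim ?K"
      unfolding K_def using rank[OF x] .
    finally have "dim ?Q \<le> dim ?K" .
    moreover have "?K \<subseteq> ?Q"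
      using linear_0[OF q(2)] by auto
    ultimately have "?K = ?Q"
      by (intro subspace_dim_equal linear_subspace_kernel lin)
    with q0 show ?thesis
      by blast
  qed
  show "v = 0"
  proof (rule ccontr)
    assume "v \<noteq> 0"
    have "v \<in> K"
      using v by (simp add: K_def)
    obtain e where e: "e > 0" "ball (\<Phi> a) e \<subseteq> V"
      using V open_contains_ball by blast
    define s where "s = e / (2 * norm v)"
    have s: "s > 0" "norm (s *\<^sub>R v) < e"
      using \<open>v \<noteq> 0\<close> e(1) by (auto simp: s_def)
    let ?c = "\<lambda>r. \<Phi> a + r *\<^sub>R v"
    have cV: "?c r \<in> V" if "r \<in> {0..s}" for r
    proof -
      have "norm (r *\<^sub>R v) \<le> norm (s *\<^sub>R v)"
        using that s(1) by (auto intro: mult_right_mono)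
      then show ?thesis
        using e(2) s(2) by (auto simp: dist_norm subset_iff)
    qed
    have "((\<lambda>r. f (g (?c r))) has_derivative (\<lambda>h. 0)) (at r within {0..s})" if "r \<in> {0..s}" for r
    proof -
      have "(?c has_derivative (\<lambda>h. h *\<^sub>R v)) (at r within {0..s})"
        by (auto intro!: derivative_eq_intros)
      then have "((\<lambda>r. g (?c r)) has_derivative (\<lambda>h. g' (?c r) (h *\<^sub>R v))) (at r within {0..s})"
        by (rule has_derivative_compose[where f="?c" and g=g]) (rule g(1)[OF cV[OF that]])
      then have "((\<lambda>r. f (g (?c r))) has_derivative (\<lambda>h. f' (g (?c r)) (g' (?c r) (h *\<^sub>R v))))
          (at r within {0..s})"
        by (rule has_derivative_compose[where f="\<lambda>r. g (?c r)" and g=f])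
          (use gU[OF cV[OF that]] U(2) der in blast)
      moreover have "f' (g (?c r)) (g' (?c r) (h *\<^sub>R v)) = 0" for h
        using ker[OF cV[OF that]] \<open>v \<in> K\<close> K by (simp add: subspace_scale)
      ultimately show ?thesis
        by simp
    qed
    then have "f (g (?c 0)) = f (g (?c s))"
      using s(1) by (intro has_derivative_zero_unique[of "{0..s}" "\<lambda>r. f (g (?c r))" 0 s]) auto
    then have "g (?c 0) = g (?c s)"
      using inj gU[OF cV[of 0]] gU[OF cV[of s]] U(2) s(1) by (auto dest: inj_onD)
    then have "?c 0 = ?c s"
      using hom cV[of 0] cV[of s] s(1) by (metis atLeastAtMost_iff homeomorphism_apply2 less_imp_le order_refl)
    then show False
      using \<open>v \<noteq> 0\<close> s(1) by simp
  qed
qed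

section \<open>Charts\<close>

lemma smooth_manifold_chart:
  "smooth_manifold M \<Longrightarrow> (U, \<phi>) \<in> mfd_atlas M \<Longrightarrow> mfd_chart (mfd_top M) (mfd_model M) U \<phi>"
  unfolding smooth_manifold_def by blast

lemma smooth_manifold_covered:
  assumes "smooth_manifold M" "x \<in> mfd_space M"
  obtains U \<phi> where "(U, \<phi>) \<in> mfd_atlas M" "x \<in> U"
  using assms unfolding smooth_manifold_def by blast

lemma mfd_chart_inj_on: "mfd_chart X E U \<phi> \<Longrightarrow> inj_on \<phi> U"
  unfolding mfd_chart_def
  by (metis homeomorphic_imp_injective_map openin_subset topspace_subtopology_subset)

lemma mfd_chart_subset: "mfd_chart X E U \<phi> \<Longrightarrow> U \<subseteq> topspace X"
  unfolding mfd_chart_def by (metis openin_subset)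

lemma mfd_chart_image_openin:
  assumes "mfd_chart X E U \<phi>" "openin X W" "W \<subseteq> U"
  shows "openin (top_of_set E) (\<phi> ` W)"
proof -
  have "openin (subtopology X U) W"
    using assms(2,3) by (rule subset_openin_subtopology)
  then have "openin (top_of_set (\<phi> ` U)) (\<phi> ` W)"
    using assms(1) unfolding mfd_chart_def
    by (meson homeomorphic_imp_open_map open_map_def)
  then show ?thesis
    using assms(1) openin_trans unfolding mfd_chart_def by blast
qed

lemma inv_into_map_prod:
  assumes "inj_on \<phi> U" "inj_on \<psi> V" "x \<in> U" "y \<in> V"
  shows "inv_into (U \<times> V) (map_prod \<phi> \<psi>) (\<phi> x, \<psi> y) = (x, y)"
  using assms inv_into_f_f[OF map_prod_inj_on[OF assms(1,2)], of "(x, y)"] by simp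

lemma inv_into_id_on: "x \<in> A \<Longrightarrow> inv_into A (\<lambda>x. x) x = x"
  using inv_into_f_f[of "\<lambda>x. x" A x] by simp

lemma mfd_chart_prod:
  assumes "mfd_chart X E U \<phi>" "mfd_chart Y F V \<psi>"
  shows "mfd_chart (prod_topology X Y) (E \<times> F) (U \<times> V) (map_prod \<phi> \<psi>)"
proof -
  obtain f where f: "homeomorphic_maps (subtopology X U) (top_of_set (\<phi> ` U)) \<phi> f"
    using assms(1) unfolding mfd_chart_def homeomorphic_map_maps by blast
  obtain g where g: "homeomorphic_maps (subtopology Y V) (top_of_set (\<psi> ` V)) \<psi> g"
    using assms(2) unfolding mfd_chart_def homeomorphic_map_maps by blast
  have "homeomorphic_maps (prod_topology (subtopology X U) (subtopology Y V))
      (prod_topology (top_of_set (\<phi> ` U)) (top_of_set (\<psi> ` V))) (\<lambda>(x, y). (\<phi> x, \<psi> y)) (\<lambda>(x, y). (f x, g y))"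
    using f g unfolding homeomorphic_maps_prod by blast
  then have "homeomorphic_map (subtopology (prod_topology X Y) (U \<times> V))
      (top_of_set (\<phi> ` U \<times> \<psi> ` V)) (map_prod \<phi> \<psi>)"
    unfolding subtopology_Times homeomorphic_map_maps map_prod_def by auto
  then show ?thesis
    using assms by (simp add: mfd_chart_def openin_prod_Times_iff openin_Times map_prod_surj_on)
qed

section \<open>Products of manifolds\<close>

lemma second_countable_prod_topology:
  assumes "second_countable X" "second_countable Y"
  shows "second_countable (prod_topology X Y)"
proof -
  obtain A where A: "countable A" "\<And>V. V \<in> A \<Longrightarrow> openin X V"
    "\<And>U x. openin X U \<Longrightarrow> x \<in> U \<Longrightarrow> \<exists>V\<in>A. x \<in> V \<and> V \<subseteq> U"
    using assms(1) unfolding second_countable_def by metis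
  obtain B where B: "countable B" "\<And>V. V \<in> B \<Longrightarrow> openin Y V"
    "\<And>U x. openin Y U \<Longrightarrow> x \<in> U \<Longrightarrow> \<exists>V\<in>B. x \<in> V \<and> V \<subseteq> U"
    using assms(2) unfolding second_countable_def by metis
  let ?C = "(\<lambda>(U, V). U \<times> V) ` (A \<times> B)"
  have "\<exists>W\<in>?C. z \<in> W \<and> W \<subseteq> U" if "openin (prod_topology X Y) U" "z \<in> U" for U z
  proof -
    obtain P Q where PQ: "openin X P" "openin Y Q" "fst z \<in> P" "snd z \<in> Q" "P \<times> Q \<subseteq> U"
      using \<open>openin (prod_topology X Y) U\<close> \<open>z \<in> U\<close>
      unfolding openin_prod_topology_alt by (metis prod.collapse)
    obtain P' Q' where P'Q': "P' \<in> A" "Q' \<in> B" "fst z \<in> P'" "snd z \<in> Q'" "P' \<subseteq> P" "Q' \<subseteq> Q"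
      using A(3)[OF PQ(1,3)] B(3)[OF PQ(2,4)] by blast
    then have "P' \<times> Q' \<in> ?C" "z \<in> P' \<times> Q'" "P' \<times> Q' \<subseteq> U"
      using PQ(5) by (auto simp: mem_Times_iff)
    then show ?thesis
      by blast
  qed
  moreover have "openin (prod_topology X Y) W" if "W \<in> ?C" for W
    using that A(2) B(2) by (auto simp: openin_prod_Times_iff)
  ultimately show ?thesis
    unfolding second_countable_def using A(1) B(1) by (intro exI[of _ ?C]) auto
qed

lemma mfd_space_prod [simp]: "mfd_space (M \<times>\<^sub>m N) = mfd_space M \<times> mfd_space N"
  by (simp add: prod_mfd_def)

lemma mfd_top_prod: "mfd_top (M \<times>\<^sub>m N) = prod_topology (mfd_top M) (mfd_top N)"
  by (simp add: prod_mfd_def)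

lemma mfd_atlas_prodE:
  assumes "(W, \<omega>) \<in> mfd_atlas (M \<times>\<^sub>m N)"
  obtains U \<phi> V \<psi> where "(U, \<phi>) \<in> mfd_atlas M" "(V, \<psi>) \<in> mfd_atlas N"
    "W = U \<times> V" "\<omega> = map_prod \<phi> \<psi>"
  using assms by (auto simp: prod_mfd_def)

lemma mfd_atlas_prodI:
  "(U, \<phi>) \<in> mfd_atlas M \<Longrightarrow> (V, \<psi>) \<in> mfd_atlas N \<Longrightarrow>
    (U \<times> V, map_prod \<phi> \<psi>) \<in> mfd_atlas (M \<times>\<^sub>m N)"
  by (auto simp: prod_mfd_def)

lemma smooth_manifoldI:
  assumes "Hausdorff_space (mfd_top M)" "second_countable (mfd_top M)" "subspace (mfd_model M)"
    and "\<And>U \<phi>. (U, \<phi>) \<in> mfd_atlas M \<Longrightarrow> mfd_chart (mfd_top M) (mfd_model M) U \<phi>"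
    and "\<And>x. x \<in> mfd_space M \<Longrightarrow> \<exists>U \<phi>. (U, \<phi>) \<in> mfd_atlas M \<and> x \<in> U"
    and "\<And>U \<phi> V \<psi>. (U, \<phi>) \<in> mfd_atlas M \<Longrightarrow> (V, \<psi>) \<in> mfd_atlas M \<Longrightarrow>
      smooth_on (\<phi> ` (U \<inter> V)) (\<psi> \<circ> inv_into U \<phi>)"
  shows "smooth_manifold M"
proof -
  have "(\<Union>(U, \<phi>)\<in>mfd_atlas M. U) = mfd_space M"
    using assms(5) mfd_chart_subset[OF assms(4)] by fastforce
  moreover have "\<forall>(U, \<phi>)\<in>mfd_atlas M. mfd_chart (mfd_top M) (mfd_model M) U \<phi>"
    by clarify (rule assms(4))
  moreover have "\<forall>(U, \<phi>)\<in>mfd_atlas M. \<forall>(V, \<psi>)\<in>mfd_atlas M.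
      smooth_on (\<phi> ` (U \<inter> V)) (\<psi> \<circ> inv_into U \<phi>)"
    by clarify (rule assms(6))
  ultimately show ?thesis
    unfolding smooth_manifold_def using assms(1-3) by (intro conjI)
qed

lemma smooth_manifold_transition:
  "smooth_manifold M \<Longrightarrow> (U, \<phi>) \<in> mfd_atlas M \<Longrightarrow> (V, \<psi>) \<in> mfd_atlas M \<Longrightarrow>
      smooth_on (\<phi> ` (U \<inter> V)) (\<psi> \<circ> inv_into U \<phi>)"
  unfolding smooth_manifold_def by (elim conjE) (drule (1) bspec, simp, drule (1) bspec, simp)+

lemma smooth_on_compose_bounded_linear:
  assumes "smooth_on B f" "bounded_linear l" "\<And>x. x \<in> A \<Longrightarrow> l x \<in> B"
  shows "smooth_on A (\<lambda>x. f (l x))"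
  using smooth_on_compose_affine[OF assms(1,2), of A 0] assms(3) by simp

lemma smooth_manifold_prod:
  assumes M: "smooth_manifold M" and N: "smooth_manifold N"
  shows "smooth_manifold (M \<times>\<^sub>m N)"
proof (rule smooth_manifoldI)
  show "Hausdorff_space (mfd_top (M \<times>\<^sub>m N))" "second_countable (mfd_top (M \<times>\<^sub>m N))"
    using M N by (auto simp: mfd_top_prod smooth_manifold_def Hausdorff_space_prod_topology
        second_countable_prod_topology)
  show "subspace (mfd_model (M \<times>\<^sub>m N))"
    using M N by (auto simp: prod_mfd_def smooth_manifold_def subspace_Times)
  show "mfd_chart (mfd_top (M \<times>\<^sub>m N)) (mfd_model (M \<times>\<^sub>m N)) W \<omega>"
    if "(W, \<omega>) \<in> mfd_atlas (M \<times>\<^sub>m N)" for W \<omega>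
    using that smooth_manifold_chart[OF M] smooth_manifold_chart[OF N]
    by (auto simp: prod_mfd_def intro: mfd_chart_prod)
  show "\<exists>W \<omega>. (W, \<omega>) \<in> mfd_atlas (M \<times>\<^sub>m N) \<and> z \<in> W" if "z \<in> mfd_space (M \<times>\<^sub>m N)" for z
  proof -
    have "fst z \<in> mfd_space M" "snd z \<in> mfd_space N"
      using that by auto
    then obtain U \<phi> V \<psi> where "(U, \<phi>) \<in> mfd_atlas M" "(V, \<psi>) \<in> mfd_atlas N" "fst z \<in> U" "snd z \<in> V"
      using smooth_manifold_covered[OF M] smooth_manifold_covered[OF N] by metis
    then show ?thesis
      using mfd_atlas_prodI by (metis mem_Times_iff)
  qed
  fix W \<omega> W' \<omega>'
  assume "(W, \<omega>) \<in> mfd_atlas (M \<times>\<^sub>m N)" "(W', \<omega>') \<in> mfd_atlas (M \<times>\<^sub>m N)"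
  then obtain U \<phi> V \<psi> U' \<phi>' V' \<psi>' where
    atl: "(U, \<phi>) \<in> mfd_atlas M" "(V, \<psi>) \<in> mfd_atlas N" "(U', \<phi>') \<in> mfd_atlas M" "(V', \<psi>') \<in> mfd_atlas N"
    and eq: "W = U \<times> V" "\<omega> = map_prod \<phi> \<psi>" "W' = U' \<times> V'" "\<omega>' = map_prod \<phi>' \<psi>'"
    by (elim mfd_atlas_prodE)
  have inj: "inj_on \<phi> U" "inj_on \<psi> V"
    using smooth_manifold_chart[OF M atl(1)] smooth_manifold_chart[OF N atl(2)] mfd_chart_inj_on by auto
  let ?A = "map_prod \<phi> \<psi> ` (U \<times> V \<inter> U' \<times> V')"
  have "smooth_on ?A (\<lambda>z. ((\<phi>' \<circ> inv_into U \<phi>) (fst z), (\<psi>' \<circ> inv_into V \<psi>) (snd z)))"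
    by (intro smooth_on_Pair
        smooth_on_compose_bounded_linear[OF smooth_manifold_transition[OF M atl(1,3)] bounded_linear_fst]
        smooth_on_compose_bounded_linear[OF smooth_manifold_transition[OF N atl(2,4)] bounded_linear_snd])
      auto
  then have "smooth_on ?A (map_prod \<phi>' \<psi>' \<circ> inv_into (U \<times> V) (map_prod \<phi> \<psi>))"
    by (rule smooth_on_cong) (auto simp: inv_into_map_prod inj)
  then show "smooth_on (\<omega> ` (W \<inter> W')) (\<omega>' \<circ> inv_into W \<omega>)"
    by (simp add: eq)
qed

lemma smooth_manifold_nonzero_reals: "smooth_manifold nonzero_reals"
proof (rule smooth_manifoldI)
  show "Hausdorff_space (mfd_top nonzero_reals)"
    by (simp add: nonzero_reals_def Hausdorff_space_subtopology)
  obtain B :: "real set set" where "countable B" "\<And>C. C \<in> B \<Longrightarrow> open C"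
    "\<And>S. open S \<Longrightarrow> \<exists>U. U \<subseteq> B \<and> S = \<Union>U"
    using univ_second_countable by blast
  then have "second_countable (euclidean :: real topology)"
    unfolding second_countable_def by (intro exI[of _ B]) (fastforce simp: subset_iff)
  then show "second_countable (mfd_top nonzero_reals)"
    by (simp add: nonzero_reals_def second_countable_subtopology)
  show "mfd_chart (mfd_top nonzero_reals) (mfd_model nonzero_reals) U \<phi>"
    if "(U, \<phi>) \<in> mfd_atlas nonzero_reals" for U \<phi>
  proof -
    have "open (- {0::real})"
      by auto
    then show ?thesis
      using that homeomorphic_map_id[of "top_of_set (- {0::real})" "top_of_set (- {0})"]
      by (auto simp: nonzero_reals_def mfd_chart_def subtopology_subtopology id_def)
  qed
  have "smooth_on (- {0}) ((\<lambda>x. x) \<circ> inv_into (- {0}) (\<lambda>x. x::real))"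
    by (rule smooth_on_cong[OF smooth_on_bounded_linear[OF bounded_linear_ident]]) (simp add: inv_into_id_on)
  then show "smooth_on (\<phi> ` (U \<inter> V)) (\<psi> \<circ> inv_into U \<phi>)"
    if "(U, \<phi>) \<in> mfd_atlas nonzero_reals" "(V, \<psi>) \<in> mfd_atlas nonzero_reals" for U \<phi> V \<psi>
    using that by (simp add: nonzero_reals_def)
qed (simp_all add: nonzero_reals_def)

section \<open>Smooth maps\<close>

lemma smooth_map_continuous: "smooth_map M N f \<Longrightarrow> continuous_map (mfd_top M) (mfd_top N) f"
  by (simp add: smooth_map_def)

lemma smooth_map_in_charts:
  "smooth_map M N f \<Longrightarrow> (U, \<phi>) \<in> mfd_atlas M \<Longrightarrow> (V, \<psi>) \<in> mfd_atlas N \<Longrightarrow>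
    smooth_on (\<phi> ` (U \<inter> f -` V)) (\<psi> \<circ> f \<circ> inv_into U \<phi>)"
  unfolding smooth_map_def by (elim conjE) (drule (1) bspec, simp, drule (1) bspec, simp)

lemma smooth_mapI:
  assumes "continuous_map (mfd_top M) (mfd_top N) f"
    and "\<And>U \<phi> V \<psi>. (U, \<phi>) \<in> mfd_atlas M \<Longrightarrow> (V, \<psi>) \<in> mfd_atlas N \<Longrightarrow>
      smooth_on (\<phi> ` (U \<inter> f -` V)) (\<psi> \<circ> f \<circ> inv_into U \<phi>)"
  shows "smooth_map M N f"
  unfolding smooth_map_def by (intro conjI assms(1), clarify) (rule assms(2))

text \<open>In product charts, freezing one argument is composition with an affine map.\<close>

lemma smooth_map_fix_fst:
  assumes f: "smooth_map (L \<times>\<^sub>m M) N f" and L: "smooth_manifold L" and M: "smooth_manifold M"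
    and g: "g \<in> mfd_space L"
  shows "smooth_map M N (\<lambda>x. f (g, x))"
proof (rule smooth_mapI)
  have "continuous_map (mfd_top M) (prod_topology (mfd_top L) (mfd_top M)) (\<lambda>x. (g, x))"
    using g by (simp add: continuous_map_paired)
  then show "continuous_map (mfd_top M) (mfd_top N) (\<lambda>x. f (g, x))"
    using continuous_map_compose[OF _ smooth_map_continuous[OF f, unfolded mfd_top_prod]]
    by (auto simp: o_def)
  fix U \<phi> V \<psi>
  assume U: "(U, \<phi>) \<in> mfd_atlas M" and V: "(V, \<psi>) \<in> mfd_atlas N"
  obtain W \<omega> where W: "(W, \<omega>) \<in> mfd_atlas L" "g \<in> W"
    using smooth_manifold_covered[OF L g] by blast
  note inj = mfd_chart_inj_on[OF smooth_manifold_chart[OF L W(1)]]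
    mfd_chart_inj_on[OF smooth_manifold_chart[OF M U]]
  let ?F = "\<psi> \<circ> f \<circ> inv_into (W \<times> U) (map_prod \<omega> \<phi>)"
  have "bounded_linear (\<lambda>a. (0, a))"
    by (simp add: bounded_linear_Pair bounded_linear_zero bounded_linear_ident)
  then have "smooth_on (\<phi> ` (U \<inter> (\<lambda>x. f (g, x)) -` V)) (\<lambda>a. ?F ((\<omega> g, 0) + (0, a)))"
    using W(2)
    by (intro smooth_on_compose_affine[OF smooth_map_in_charts[OF f mfd_atlas_prodI[OF W(1) U] V]]) auto
  then show "smooth_on (\<phi> ` (U \<inter> (\<lambda>x. f (g, x)) -` V)) (\<psi> \<circ> (\<lambda>x. f (g, x)) \<circ> inv_into U \<phi>)"
    by (rule smooth_on_cong) (use W(2) in \<open>auto simp: inv_into_map_prod inj\<close>)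
qed

lemma smooth_map_fix_snd:
  assumes f: "smooth_map (L \<times>\<^sub>m M) N f" and L: "smooth_manifold L" and M: "smooth_manifold M"
    and x: "x \<in> mfd_space M"
  shows "smooth_map L N (\<lambda>g. f (g, x))"
proof (rule smooth_mapI)
  have "continuous_map (mfd_top L) (prod_topology (mfd_top L) (mfd_top M)) (\<lambda>g. (g, x))"
    using x by (simp add: continuous_map_paired)
  then show "continuous_map (mfd_top L) (mfd_top N) (\<lambda>g. f (g, x))"
    using continuous_map_compose[OF _ smooth_map_continuous[OF f, unfolded mfd_top_prod]]
    by (auto simp: o_def)
  fix W \<omega> V \<psi>
  assume W: "(W, \<omega>) \<in> mfd_atlas L" and V: "(V, \<psi>) \<in> mfd_atlas N"
  obtain U \<phi> where U: "(U, \<phi>) \<in> mfd_atlas M" "x \<in> U"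
    using smooth_manifold_covered[OF M x] by blast
  note inj = mfd_chart_inj_on[OF smooth_manifold_chart[OF L W]]
    mfd_chart_inj_on[OF smooth_manifold_chart[OF M U(1)]]
  let ?F = "\<psi> \<circ> f \<circ> inv_into (W \<times> U) (map_prod \<omega> \<phi>)"
  have "bounded_linear (\<lambda>a. (a, 0))"
    by (simp add: bounded_linear_Pair bounded_linear_zero bounded_linear_ident)
  then have "smooth_on (\<omega> ` (W \<inter> (\<lambda>g. f (g, x)) -` V)) (\<lambda>a. ?F ((0, \<phi> x) + (a, 0)))"
    using U(2)
    by (intro smooth_on_compose_affine[OF smooth_map_in_charts[OF f mfd_atlas_prodI[OF W U(1)] V]]) auto
  then show "smooth_on (\<omega> ` (W \<inter> (\<lambda>g. f (g, x)) -` V)) (\<psi> \<circ> (\<lambda>g. f (g, x)) \<circ> inv_into W \<omega>)"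
    by (rule smooth_on_cong) (use U(2) in \<open>auto simp: inv_into_map_prod inj\<close>)
qed

section \<open>The lifted action\<close>

lemma group_actionI:
  assumes "group G"
    and maps: "\<And>g x. g \<in> carrier G \<Longrightarrow> x \<in> X \<Longrightarrow> \<beta> g x \<in> X"
    and ext: "\<And>g. g \<in> carrier G \<Longrightarrow> \<beta> g \<in> extensional X"
    and mult: "\<And>g h x. g \<in> carrier G \<Longrightarrow> h \<in> carrier G \<Longrightarrow> x \<in> X \<Longrightarrow> \<beta> (g \<otimes>\<^bsub>G\<^esub> h) x = \<beta> g (\<beta> h x)"
    and one: "\<And>x. x \<in> X \<Longrightarrow> \<beta> \<one>\<^bsub>G\<^esub> x = x"
  shows "group_action G X \<beta>"
proof -
  interpret group G by fact
  have inv: "\<beta> (inv\<^bsub>G\<^esub> g) (\<beta> g x) = x" "\<beta> g (\<beta> (inv\<^bsub>G\<^esub> g) x) = x"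
    if "g \<in> carrier G" "x \<in> X" for g x
    using that mult[of "inv\<^bsub>G\<^esub> g" g x] mult[of g "inv\<^bsub>G\<^esub> g" x] one by simp_all
  have "\<beta> g \<in> Bij X" if "g \<in> carrier G" for g
  proof -
    have "bij_betw (\<beta> g) X X"
      using that maps inv by (intro bij_betwI[of _ _ _ "\<beta> (inv\<^bsub>G\<^esub> g)"]) auto
    then show ?thesis
      using ext[OF that] by (simp add: Bij_def)
  qed
  moreover have "\<beta> (g \<otimes>\<^bsub>G\<^esub> h) = compose X (\<beta> g) (\<beta> h)" if "g \<in> carrier G" "h \<in> carrier G" for g h
    using that ext mult by (intro extensionalityI[of _ X]) (auto simp: compose_def)
  ultimately have "\<beta> \<in> hom G (BijGroup X)"
    by (auto simp: hom_def BijGroup_def)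
  then show ?thesis
    by (simp add: group_action_def group_hom_def group_hom_axioms_def group_BijGroup assms(1))
qed

lemma mfd_space_nonzero_reals [simp]: "mfd_space nonzero_reals = - {0}"
  by (simp add: nonzero_reals_def)

lemma mfd_space_lift: "mfd_space (lift_mfd M) = mfd_space M \<times> - {0}"
  by (simp add: lift_mfd_def)

lemma lift_action_apply:
  "x \<in> mfd_space M \<Longrightarrow> t \<noteq> 0 \<Longrightarrow> lift_action M \<alpha> \<mu> g (x, t) = (\<alpha> g x, t * \<mu> g x)"
  by (simp add: lift_action_def mfd_space_lift)

lemma smooth_action_group: "smooth_action G L M \<alpha> \<Longrightarrow> group G"
  and smooth_action_group_action: "smooth_action G L M \<alpha> \<Longrightarrow> group_action G (mfd_space M) \<alpha>"
  and smooth_action_smooth_map: "smooth_action G L M \<alpha> \<Longrightarrow> smooth_map (L \<times>\<^sub>m M) M (\<lambda>(g, x). \<alpha> g x)"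
  and smooth_action_smooth_manifold: "smooth_action G L M \<alpha> \<Longrightarrow> smooth_manifold M"
  and smooth_action_lie_group: "smooth_action G L M \<alpha> \<Longrightarrow> lie_group G L"
  by (simp_all add: smooth_action_def lie_group_def)

lemma lie_group_smooth_manifold: "lie_group G L \<Longrightarrow> smooth_manifold L"
  and lie_group_space: "lie_group G L \<Longrightarrow> mfd_space L = carrier G"
  and lie_group_group: "lie_group G L \<Longrightarrow> group G"
  by (simp_all add: lie_group_def)

lemma group_action_closed:
  "group_action G X \<alpha> \<Longrightarrow> g \<in> carrier G \<Longrightarrow> x \<in> X \<Longrightarrow> \<alpha> g x \<in> X"
  using group_action.element_image by metis

lemma group_action_one: "group_action G X \<alpha> \<Longrightarrow> x \<in> X \<Longrightarrow> \<alpha> \<one>\<^bsub>G\<^esub> x = x"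
  using group_action.id_eq_one by (metis restrict_apply')

lemma group_action_lift:
  assumes "smooth_action G L M \<alpha>" "multiplier G (mfd_space M) \<alpha> \<mu>"
  shows "group_action G (mfd_space (lift_mfd M)) (lift_action M \<alpha> \<mu>)"
proof (rule group_actionI)
  note act = smooth_action_group_action[OF assms(1)]
  have mu: "\<mu> g x \<noteq> 0" if "g \<in> carrier G" "x \<in> mfd_space M" for g x
    using assms(2) that by (simp add: multiplier_def)
  show "group G"
    using assms(1) by (rule smooth_action_group)
  show "lift_action M \<alpha> \<mu> g p \<in> mfd_space (lift_mfd M)"
    if g: "g \<in> carrier G" and p: "p \<in> mfd_space (lift_mfd M)" for g p
  proof -
    obtain x t where "p = (x, t)" "x \<in> mfd_space M" "t \<noteq> 0"
      using p by (auto simp: mfd_space_lift)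
    then show ?thesis
      using group_action_closed[OF act g] mu[OF g] by (simp add: mfd_space_lift lift_action_apply)
  qed
  show "lift_action M \<alpha> \<mu> g \<in> extensional (mfd_space (lift_mfd M))" for g
    by (simp add: lift_action_def)
  show "lift_action M \<alpha> \<mu> (g \<otimes>\<^bsub>G\<^esub> h) p = lift_action M \<alpha> \<mu> g (lift_action M \<alpha> \<mu> h p)"
    if g: "g \<in> carrier G" and h: "h \<in> carrier G" and p: "p \<in> mfd_space (lift_mfd M)" for g h p
  proof -
    obtain x t where x: "p = (x, t)" "x \<in> mfd_space M" "t \<noteq> 0"
      using p by (auto simp: mfd_space_lift)
    have "\<mu> (g \<otimes>\<^bsub>G\<^esub> h) x = \<mu> g (\<alpha> h x) * \<mu> h x"
      using assms(2) g h x(2) by (simp add: multiplier_def)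
    then show ?thesis
      using x group_action_closed[OF act h] mu[OF h] group_action.composition_rule[OF act _ g h]
      by (simp add: lift_action_apply)
  qed
  show "lift_action M \<alpha> \<mu> \<one>\<^bsub>G\<^esub> p = p" if p: "p \<in> mfd_space (lift_mfd M)" for p
  proof -
    obtain x t where "p = (x, t)" "x \<in> mfd_space M" "t \<noteq> 0"
      using p by (auto simp: mfd_space_lift)
    then show ?thesis
      using assms(2) group_action_one[OF act] by (simp add: lift_action_apply multiplier_def)
  qed
qed

lemma mfd_atlas_liftE:
  assumes "(W, \<omega>) \<in> mfd_atlas (lift_mfd M)"
  obtains V \<psi> where "(V, \<psi>) \<in> mfd_atlas M" "W = V \<times> - {0}" "\<omega> = map_prod \<psi> (\<lambda>t. t)"
  using assms unfolding lift_mfd_def by (auto elim!: mfd_atlas_prodE simp: nonzero_reals_def)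

lemma mfd_atlas_nonzero_reals: "(- {0}, \<lambda>t. t) \<in> mfd_atlas nonzero_reals"
  by (simp add: nonzero_reals_def)

text \<open>In product charts the first component is the given action and the second is the fibre coordinate
  times the multiplier, both evaluated after the linear map that forgets the fibre coordinate.\<close>

lemma smooth_map_lift_action:
  assumes act: "smooth_action G L M \<alpha>" and mul: "smooth_multiplier G L M \<alpha> \<mu>"
  shows "smooth_map (L \<times>\<^sub>m lift_mfd M) (lift_mfd M) (\<lambda>(g, p). lift_action M \<alpha> \<mu> g p)"
proof (rule smooth_mapI)
  note L = lie_group_smooth_manifold[OF smooth_action_lie_group[OF act]]
  note M = smooth_action_smooth_manifold[OF act]
  note sa = smooth_action_smooth_map[OF act]
  have sm: "smooth_map (L \<times>\<^sub>m M) nonzero_reals (\<lambda>(g, x). \<mu> g x)"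
    using mul by (simp add: smooth_multiplier_def)
  let ?a = "\<lambda>(g, p). lift_action M \<alpha> \<mu> g p"
  let ?X = "mfd_top (L \<times>\<^sub>m lift_mfd M)"
  let ?pr = "\<lambda>z. (fst z, fst (snd z))"
  have X: "?X = prod_topology (mfd_top L) (prod_topology (mfd_top M) (top_of_set (- {0})))"
    by (simp add: prod_mfd_def lift_mfd_def nonzero_reals_def)
  have pr: "continuous_map ?X (prod_topology (mfd_top L) (mfd_top M)) ?pr"
    unfolding X by (intro continuous_map_pairedI continuous_map_fst
        continuous_map_compose[OF continuous_map_snd continuous_map_fst, unfolded o_def])
  have c1: "continuous_map ?X (mfd_top M) (\<lambda>z. \<alpha> (fst z) (fst (snd z)))"
    using continuous_map_compose[OF pr smooth_map_continuous[OF sa, unfolded mfd_top_prod]]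
    by (simp add: o_def)
  have c2: "continuous_map ?X (top_of_set (- {0})) (\<lambda>z. \<mu> (fst z) (fst (snd z)))"
    using continuous_map_compose[OF pr smooth_map_continuous[OF sm, unfolded mfd_top_prod]]
    by (simp add: o_def nonzero_reals_def)
  have c3: "continuous_map ?X (top_of_set (- {0})) (\<lambda>z. snd (snd z))"
    unfolding X by (rule continuous_map_compose[OF continuous_map_snd continuous_map_snd, unfolded o_def])
  have c4: "continuous_map ?X (top_of_set (- {0})) (\<lambda>z. snd (snd z) * \<mu> (fst z) (fst (snd z)))"
    using c2 c3 by (simp add: continuous_map_in_subtopology continuous_map_real_mult Pi_iff)
  have "continuous_map ?X (mfd_top (lift_mfd M))
      (\<lambda>z. (\<alpha> (fst z) (fst (snd z)), snd (snd z) * \<mu> (fst z) (fst (snd z))))"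
    using continuous_map_pairedI[OF c1 c4] by (simp add: lift_mfd_def mfd_top_prod nonzero_reals_def)
  then show "continuous_map ?X (mfd_top (lift_mfd M)) ?a"
    by (rule continuous_map_eq) (simp add: lift_action_apply split_beta mfd_space_lift mem_Times_iff
        lift_action_def)
  fix W \<omega> W' \<omega>'
  assume "(W, \<omega>) \<in> mfd_atlas (L \<times>\<^sub>m lift_mfd M)" "(W', \<omega>') \<in> mfd_atlas (lift_mfd M)"
  then obtain U \<phi> V \<psi> V' \<psi>' where U: "(U, \<phi>) \<in> mfd_atlas L" and V: "(V, \<psi>) \<in> mfd_atlas M"
    and V': "(V', \<psi>') \<in> mfd_atlas M"
    and eq: "W = U \<times> (V \<times> - {0})" "\<omega> = map_prod \<phi> (map_prod \<psi> (\<lambda>t. t))"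
      "W' = V' \<times> - {0}" "\<omega>' = map_prod \<psi>' (\<lambda>t. t)"
    by (elim mfd_atlas_prodE mfd_atlas_liftE) blast
  note inj = mfd_chart_inj_on[OF smooth_manifold_chart[OF L U]]
    mfd_chart_inj_on[OF smooth_manifold_chart[OF M V]]
  note sub = mfd_chart_subset[OF smooth_manifold_chart[OF L U]]
    mfd_chart_subset[OF smooth_manifold_chart[OF M V]]
  have mu: "\<mu> g x \<noteq> 0" if "g \<in> U" "x \<in> V" for g x
  proof -
    have "g \<in> carrier G" "x \<in> mfd_space M"
      using that sub lie_group_space[OF smooth_action_lie_group[OF act]] by auto
    then show ?thesis
      using mul by (simp add: smooth_multiplier_def multiplier_def)
  qed
  let ?inv = "inv_into (U \<times> V) (map_prod \<phi> \<psi>)"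
  let ?A = "\<omega> ` (W \<inter> ?a -` W')"
  let ?F = "\<lambda>z. ((\<psi>' \<circ> (\<lambda>(g, x). \<alpha> g x) \<circ> ?inv) (?pr z), snd (snd z) * ((\<lambda>t. t) \<circ> (\<lambda>(g, x). \<mu> g x) \<circ> ?inv) (?pr z))"
  have bl: "bounded_linear ?pr" "bounded_linear (\<lambda>z. snd (snd z))"
    by (intro bounded_linear_Pair bounded_linear_fst bounded_linear_compose[OF bounded_linear_fst]
        bounded_linear_compose[OF bounded_linear_snd] bounded_linear_snd)+
  have A: "\<exists>g x t. z = (\<phi> g, \<psi> x, t) \<and> g \<in> U \<and> x \<in> V \<and> t \<noteq> 0 \<and> \<alpha> g x \<in> V'" if z: "z \<in> ?A" for z
  proof -
    obtain w where w: "w \<in> W" "?a w \<in> W'" "z = \<omega> w"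
      using z by blast
    obtain g x t where gxt: "w = (g, x, t)" "g \<in> U" "x \<in> V" "t \<noteq> 0"
      using w(1) by (auto simp: eq)
    moreover have "x \<in> mfd_space M"
      using sub(2) gxt by auto
    ultimately have "\<alpha> g x \<in> V'"
      using w(2) by (simp add: eq lift_action_apply)
    with gxt w(3) show ?thesis
      by (auto simp: eq)
  qed
  have "smooth_on ?A ?F"
  proof (intro smooth_on_Pair smooth_on_mult smooth_on_bounded_linear[OF bl(2)])
    show "smooth_on ?A (\<lambda>z. (\<psi>' \<circ> (\<lambda>(g, x). \<alpha> g x) \<circ> ?inv) (?pr z))"
    proof (rule smooth_on_compose_bounded_linear[OF smooth_map_in_charts[OF sa mfd_atlas_prodI[OF U V] V'] bl(1)])
      fix z assume "z \<in> ?A"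
      then obtain g x t where "z = (\<phi> g, \<psi> x, t)" "g \<in> U" "x \<in> V" "\<alpha> g x \<in> V'"
        using A by blast
      then show "?pr z \<in> map_prod \<phi> \<psi> ` (U \<times> V \<inter> (\<lambda>(g, x). \<alpha> g x) -` V')"
        by (intro image_eqI[of _ _ "(g, x)"]) auto
    qed
    show "smooth_on ?A (\<lambda>z. ((\<lambda>t. t) \<circ> (\<lambda>(g, x). \<mu> g x) \<circ> ?inv) (?pr z))"
    proof (rule smooth_on_compose_bounded_linear[OF
          smooth_map_in_charts[OF sm mfd_atlas_prodI[OF U V] mfd_atlas_nonzero_reals] bl(1)])
      fix z assume "z \<in> ?A"
      then obtain g x t where "z = (\<phi> g, \<psi> x, t)" "g \<in> U" "x \<in> V"
        using A by blast
      then show "?pr z \<in> map_prod \<phi> \<psi> ` (U \<times> V \<inter> (\<lambda>(g, x). \<mu> g x) -` (- {0}))"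
        using mu by (intro image_eqI[of _ _ "(g, x)"]) auto
    qed
  qed
  then show "smooth_on ?A (\<omega>' \<circ> ?a \<circ> inv_into W \<omega>)"
  proof (rule smooth_on_cong)
    fix z assume "z \<in> ?A"
    then obtain g x t where z: "z = (\<phi> g, \<psi> x, t)" "g \<in> U" "x \<in> V" "t \<noteq> 0"
      using A by blast
    have "inv_into W \<omega> z = (g, x, t)"
      using inv_into_map_prod[OF inj(1) map_prod_inj_on[OF inj(2), of "\<lambda>t. t" "- {0}"], of g "(x, t)"] z
      by (simp add: eq)
    moreover have "?inv (?pr z) = (g, x)"
      using inv_into_map_prod[OF inj] z by simp
    moreover have "x \<in> mfd_space M"
      using sub z by auto
    ultimately show "?F z = (\<omega>' \<circ> ?a \<circ> inv_into W \<omega>) z"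
      using z by (simp add: eq lift_action_apply)
  qed
qed

lemma smooth_action_lift:
  assumes "smooth_action G L M \<alpha>" "smooth_multiplier G L M \<alpha> \<mu>"
  shows "smooth_action G L (lift_mfd M) (lift_action M \<alpha> \<mu>)"
  unfolding smooth_action_def
proof (intro conjI)
  show "lie_group G L"
    using assms(1) by (rule smooth_action_lie_group)
  show "smooth_manifold (lift_mfd M)"
    unfolding lift_mfd_def using smooth_action_smooth_manifold[OF assms(1)] smooth_manifold_nonzero_reals
    by (rule smooth_manifold_prod)
  show "group_action G (mfd_space (lift_mfd M)) (lift_action M \<alpha> \<mu>)"
    using assms by (intro group_action_lift) (auto simp: smooth_multiplier_def)
  show "smooth_map (L \<times>\<^sub>m lift_mfd M) (lift_mfd M) (\<lambda>(g, p). lift_action M \<alpha> \<mu> g p)"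
    using assms by (rule smooth_map_lift_action)
qed

section \<open>Transport of structure\<close>

text \<open>The orbit of a point with trivial stabilizer receives its manifold structure from the group; the
  topology is a separate argument because that of the orbit is prescribed.\<close>

definition transport_mfd ::
    "('a, 'e::euclidean_space) mfd \<Rightarrow> 'b topology \<Rightarrow> ('a \<Rightarrow> 'b) \<Rightarrow> ('b, 'e) mfd" where
  "transport_mfd L Y f =
     \<lparr>mfd_top = Y, mfd_model = mfd_model L,
      mfd_atlas = {(f ` U, \<phi> \<circ> inv_into (mfd_space L) f) | U \<phi>. (U, \<phi>) \<in> mfd_atlas L}\<rparr>"

lemma transport_chart:
  assumes "inj_on f X" "U \<subseteq> X" "inj_on \<phi> U"
  shows "\<And>A. A \<subseteq> U \<Longrightarrow> (\<phi> \<circ> inv_into X f) ` f ` A = \<phi> ` A"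
    and "\<And>x. x \<in> U \<Longrightarrow> inv_into (f ` U) (\<phi> \<circ> inv_into X f) (\<phi> x) = f x"
proof -
  have inv: "inv_into X f (f x) = x" if "x \<in> U" for x
    using that assms(1,2) by (simp add: inv_into_f_f subsetD)
  then show "(\<phi> \<circ> inv_into X f) ` f ` A = \<phi> ` A" if "A \<subseteq> U" for A
    using that by (force simp: image_iff subset_iff)
  fix x assume "x \<in> U"
  have "inj_on (\<phi> \<circ> inv_into X f) (f ` U)"
    using assms(3) inv by (auto simp: inj_on_def)
  then show "inv_into (f ` U) (\<phi> \<circ> inv_into X f) (\<phi> x) = f x"
    using inv_into_f_f[of "\<phi> \<circ> inv_into X f" "f ` U" "f x"] \<open>x \<in> U\<close> inv by simp
qed

lemma smooth_manifold_transport: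
  assumes L: "smooth_manifold L" and f: "homeomorphic_map (mfd_top L) Y f"
  shows "smooth_manifold (transport_mfd L Y f)"
proof (rule smooth_manifoldI)
  let ?X = "mfd_top L" and ?S = "transport_mfd L Y f"
  let ?h = "inv_into (topspace ?X) f"
  have hs: "?X homeomorphic_space Y"
    using f by (rule homeomorphic_map_imp_homeomorphic_space)
  have inj: "inj_on f (topspace ?X)" and surj: "f ` topspace ?X = topspace Y"
    using f homeomorphic_imp_injective_map homeomorphic_imp_surjective_map by blast+
  show "Hausdorff_space (mfd_top ?S)" "second_countable (mfd_top ?S)" "subspace (mfd_model ?S)"
    using L homeomorphic_Hausdorff_space[OF hs] homeomorphic_space_second_countability[OF hs]
    by (auto simp: transport_mfd_def smooth_manifold_def)
  show "\<exists>U \<phi>. (U, \<phi>) \<in> mfd_atlas ?S \<and> y \<in> U" if "y \<in> mfd_space ?S" for y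
  proof -
    have "y \<in> f ` topspace ?X"
      using that by (simp add: transport_mfd_def surj)
    then obtain x where "x \<in> topspace ?X" "y = f x"
      by blast
    then obtain U \<phi> where "(U, \<phi>) \<in> mfd_atlas L" "y \<in> f ` U"
      using smooth_manifold_covered[OF L] by (metis imageI)
    moreover from this(1) have "(f ` U, \<phi> \<circ> ?h) \<in> mfd_atlas ?S"
      unfolding transport_mfd_def by auto
    ultimately show ?thesis
      by blast
  qed
  show "mfd_chart (mfd_top ?S) (mfd_model ?S) W \<omega>" if W: "(W, \<omega>) \<in> mfd_atlas ?S" for W \<omega>
  proof -
    obtain U \<phi> where U: "(U, \<phi>) \<in> mfd_atlas L" and eq: "W = f ` U" "\<omega> = \<phi> \<circ> ?h"
      using W by (auto simp: transport_mfd_def)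
    note ch = smooth_manifold_chart[OF L U]
    have sub: "U \<subseteq> topspace ?X"
      using ch by (rule mfd_chart_subset)
    have img: "\<omega> ` W = \<phi> ` U"
      unfolding eq by (rule transport_chart(1)[OF inj sub mfd_chart_inj_on[OF ch] order_refl])
    obtain k where k: "homeomorphic_maps ?X Y f k"
      using f unfolding homeomorphic_map_maps by blast
    have "k y = ?h y" if y: "y \<in> topspace Y" for y
    proof -
      have "f (k y) = y" "k y \<in> topspace ?X"
        using k y unfolding homeomorphic_maps_def continuous_map_def by auto
      then show ?thesis
        using inv_into_f_f[OF inj] by metis
    qed
    then have "homeomorphic_map Y ?X ?h"
      using k homeomorphic_map_eq[of Y ?X k ?h] by (simp add: homeomorphic_maps_map)
    moreover have "?h ` f ` U = U"
      using inj sub by (rule inv_into_image_cancel)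
    then have "?h ` (topspace Y \<inter> f ` U) = topspace ?X \<inter> U"
      using sub surj by (metis image_mono inf.absorb_iff2)
    ultimately have "homeomorphic_map (subtopology Y (f ` U)) (subtopology ?X U) ?h"
      by (rule homeomorphic_map_subtopologies)
    moreover have "homeomorphic_map (subtopology ?X U) (top_of_set (\<phi> ` U)) \<phi>"
      using ch by (simp add: mfd_chart_def)
    ultimately have "homeomorphic_map (subtopology Y (f ` U)) (top_of_set (\<phi> ` U)) (\<phi> \<circ> ?h)"
      by (rule homeomorphic_map_compose)
    moreover have "openin Y (f ` U)"
      using f ch by (meson homeomorphic_imp_open_map mfd_chart_def open_map_def)
    ultimately show ?thesis
      using img ch by (simp add: mfd_chart_def transport_mfd_def eq)
  qed
  show "smooth_on (\<omega> ` (W \<inter> W')) (\<omega>' \<circ> inv_into W \<omega>)"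
    if W: "(W, \<omega>) \<in> mfd_atlas ?S" and W': "(W', \<omega>') \<in> mfd_atlas ?S" for W \<omega> W' \<omega>'
  proof -
    obtain U \<phi> where U: "(U, \<phi>) \<in> mfd_atlas L" and eq: "W = f ` U" "\<omega> = \<phi> \<circ> ?h"
      using W by (auto simp: transport_mfd_def)
    obtain V \<psi> where V: "(V, \<psi>) \<in> mfd_atlas L" and eq': "W' = f ` V" "\<omega>' = \<psi> \<circ> ?h"
      using W' by (auto simp: transport_mfd_def)
    note U' = mfd_chart_subset[OF smooth_manifold_chart[OF L U]] mfd_chart_inj_on[OF smooth_manifold_chart[OF L U]]
    have "W \<inter> W' = f ` (U \<inter> V)"
      unfolding eq eq' using inj_on_image_Int[OF inj U'(1)] mfd_chart_subset[OF smooth_manifold_chart[OF L V]]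
      by simp
    then have "\<omega> ` (W \<inter> W') = \<phi> ` (U \<inter> V)"
      using transport_chart(1)[OF inj U', of "U \<inter> V"] by (simp add: eq)
    moreover have "smooth_on (\<phi> ` (U \<inter> V)) (\<omega>' \<circ> inv_into W \<omega>)"
      using smooth_manifold_transition[OF L U V]
    proof (rule smooth_on_cong)
      fix a assume "a \<in> \<phi> ` (U \<inter> V)"
      then obtain x where "x \<in> U" "x \<in> V" "a = \<phi> x"
        by blast
      then show "(\<psi> \<circ> inv_into U \<phi>) a = (\<omega>' \<circ> inv_into W \<omega>) a"
        using transport_chart(2)[OF inj U'] U' inj by (simp add: eq eq' inv_into_f_f subset_iff)
    qed
    ultimately show ?thesis
      by simp
  qed
qed

lemma immersion_transport:
  assumes L: "smooth_manifold L" and f: "homeomorphic_map (mfd_top L) Y f"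
    and imm: "immersion L M f"
  shows "immersion (transport_mfd L Y f) M (\<lambda>y. y)"
proof -
  let ?S = "transport_mfd L Y f"
  let ?h = "inv_into (mfd_space L) f"
  have inj: "inj_on f (mfd_space L)"
    using f by (rule homeomorphic_imp_injective_map)
  have sm: "smooth_map L M f"
    using imm by (simp add: immersion_def)
  have coord: "(\<phi> \<circ> ?h) ` (f ` U \<inter> (\<lambda>y. y) -` V) = \<phi> ` (U \<inter> f -` V)"
    "\<And>a. a \<in> \<phi> ` (U \<inter> f -` V) \<Longrightarrow>
      (\<psi> \<circ> (\<lambda>y. y) \<circ> inv_into (f ` U) (\<phi> \<circ> ?h)) a = (\<psi> \<circ> f \<circ> inv_into U \<phi>) a"
    if U: "(U, \<phi>) \<in> mfd_atlas L" for U \<phi> V and \<psi> :: "'c \<Rightarrow> 'd"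
  proof -
    note U' = mfd_chart_subset[OF smooth_manifold_chart[OF L U]] mfd_chart_inj_on[OF smooth_manifold_chart[OF L U]]
    have "f ` U \<inter> (\<lambda>y. y) -` V = f ` (U \<inter> f -` V)"
      by auto
    then show "(\<phi> \<circ> ?h) ` (f ` U \<inter> (\<lambda>y. y) -` V) = \<phi> ` (U \<inter> f -` V)"
      using transport_chart(1)[OF inj U', of "U \<inter> f -` V"] by simp
    show "(\<psi> \<circ> (\<lambda>y. y) \<circ> inv_into (f ` U) (\<phi> \<circ> ?h)) a = (\<psi> \<circ> f \<circ> inv_into U \<phi>) a"
      if "a \<in> \<phi> ` (U \<inter> f -` V)" for a
      using that transport_chart(2)[OF inj U'] U'(2) by (auto simp: inv_into_f_f)
  qed
  have "continuous_map (mfd_top L) (mfd_top M) ((\<lambda>y. y) \<circ> f)"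
    using smooth_map_continuous[OF sm] by (simp add: o_def)
  then have "continuous_map Y (mfd_top M) (\<lambda>y. y)"
    using f by (metis continuous_compose_quotient_map homeomorphic_map_def)
  then have cont: "continuous_map (mfd_top ?S) (mfd_top M) (\<lambda>y. y)"
    by (simp add: transport_mfd_def)
  have "smooth_map ?S M (\<lambda>y. y)"
  proof (rule smooth_mapI[OF cont])
    fix W \<omega> V \<psi> assume W: "(W, \<omega>) \<in> mfd_atlas ?S" and V: "(V, \<psi>) \<in> mfd_atlas M"
    then obtain U \<phi> where U: "(U, \<phi>) \<in> mfd_atlas L" and eq: "W = f ` U" "\<omega> = \<phi> \<circ> ?h"
      by (auto simp: transport_mfd_def)
    show "smooth_on (\<omega> ` (W \<inter> (\<lambda>y. y) -` V)) (\<psi> \<circ> (\<lambda>y. y) \<circ> inv_into W \<omega>)"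
      unfolding eq coord(1)[OF U]
      by (rule smooth_on_cong[OF smooth_map_in_charts[OF sm U V]]) (simp only: coord(2)[OF U])
  qed
  moreover have "\<exists>D. ((\<psi> \<circ> (\<lambda>y. y) \<circ> inv_into W \<omega>) has_derivative D)
        (at (\<omega> p) within \<omega> ` (W \<inter> (\<lambda>y. y) -` V)) \<and> inj_on D (mfd_model ?S)"
    if W: "(W, \<omega>) \<in> mfd_atlas ?S" and V: "(V, \<psi>) \<in> mfd_atlas M" and p: "p \<in> W \<inter> (\<lambda>y. y) -` V"
    for W \<omega> V \<psi> p
  proof -
    obtain U \<phi> where U: "(U, \<phi>) \<in> mfd_atlas L" and eq: "W = f ` U" "\<omega> = \<phi> \<circ> ?h"
      using W by (auto simp: transport_mfd_def)
    obtain x where x: "x \<in> U \<inter> f -` V" "p = f x"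
      using p eq by auto
    obtain D where D: "((\<psi> \<circ> f \<circ> inv_into U \<phi>) has_derivative D) (at (\<phi> x) within \<phi> ` (U \<inter> f -` V))"
      "inj_on D (mfd_model L)"
      using imm U V x(1) unfolding immersion_def by fastforce
    have "\<omega> p = \<phi> x"
      using x inj mfd_chart_subset[OF smooth_manifold_chart[OF L U]] by (auto simp: eq inv_into_f_f)
    moreover have "((\<psi> \<circ> (\<lambda>y. y) \<circ> inv_into W \<omega>) has_derivative D) (at (\<phi> x) within \<phi> ` (U \<inter> f -` V))"
      using x(1) unfolding eq
      by (intro has_derivative_transform[OF _ _ D(1)]) (auto simp only: coord(2)[OF U])
    ultimately show ?thesis
      using D(2) unfolding eq coord(1)[OF U] by (auto simp: transport_mfd_def)
  qed
  ultimately show ?thesis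
    unfolding immersion_def by blast
qed

section \<open>Free orbits\<close>

lemma inj_on_orbit_map:
  assumes act: "group_action G X \<alpha>" and y: "y \<in> X" and free: "stabilizer G \<alpha> y = {\<one>\<^bsub>G\<^esub>}"
  shows "inj_on (\<lambda>g. \<alpha> g y) (carrier G)"
proof (rule inj_onI)
  interpret group_action G X \<alpha> by fact
  interpret group G using group_hom by (simp add: group_hom_def)
  fix g h assume gh: "g \<in> carrier G" "h \<in> carrier G" "\<alpha> g y = \<alpha> h y"
  have "\<alpha> (inv\<^bsub>G\<^esub> h \<otimes>\<^bsub>G\<^esub> g) y = \<alpha> (inv\<^bsub>G\<^esub> h \<otimes>\<^bsub>G\<^esub> h) y"
    using gh composition_rule[OF y, of "inv\<^bsub>G\<^esub> h" g] composition_rule[OF y, of "inv\<^bsub>G\<^esub> h" h]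
    by (simp del: l_inv)
  also have "\<dots> = y"
    using gh(2) y group_action_one[OF act y] by simp
  finally have "inv\<^bsub>G\<^esub> h \<otimes>\<^bsub>G\<^esub> g \<in> stabilizer G \<alpha> y"
    using gh by (simp add: stabilizer_def)
  then have "inv\<^bsub>G\<^esub> h \<otimes>\<^bsub>G\<^esub> g = \<one>\<^bsub>G\<^esub>"
    using free by simp
  then show "g = h"
    using gh by (metis inv_equality inv_inv inv_closed)
qed

lemma smooth_map_orbit_map:
  assumes "smooth_action G L M \<alpha>" "y \<in> mfd_space M"
  shows "smooth_map L M (\<lambda>g. \<alpha> g y)"
  using smooth_map_fix_snd[OF smooth_action_smooth_map[OF assms(1)]
      lie_group_smooth_manifold[OF smooth_action_lie_group[OF assms(1)]]
      smooth_action_smooth_manifold[OF assms(1)] assms(2)]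
  by simp

lemma smooth_map_acting:
  assumes act: "smooth_action G L M \<alpha>" and h: "h \<in> carrier G"
  shows "smooth_map M M (\<alpha> h)"
proof -
  note lie = smooth_action_lie_group[OF act]
  have "h \<in> mfd_space L"
    using h lie_group_space[OF lie] by simp
  then show ?thesis
    using smooth_map_fix_fst[OF smooth_action_smooth_map[OF act]
        lie_group_smooth_manifold[OF lie] smooth_action_smooth_manifold[OF act]]
    by simp
qed

lemma smooth_map_left_translation:
  assumes lie: "lie_group G L" and h: "h \<in> carrier G"
  shows "smooth_map L L (\<lambda>g. h \<otimes>\<^bsub>G\<^esub> g)"
proof -
  have "h \<in> mfd_space L"
    using h lie_group_space[OF lie] by simp
  moreover have "smooth_map (L \<times>\<^sub>m L) L (\<lambda>(g, h). g \<otimes>\<^bsub>G\<^esub> h)"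
    using lie by (simp add: lie_group_def)
  ultimately show ?thesis
    using smooth_map_fix_fst lie_group_smooth_manifold[OF lie] by fastforce
qed

text \<open>Equivariance of the orbit map: translating by \<open>h = g2 \<otimes> inv g1\<close> before it agrees with acting by \<open>h\<close>
  after it.  Differentiating at \<open>g1\<close> gives \<open>D' \<circ> B = Q \<circ> D\<close>, where \<open>B\<close>, the derivative of the left
  translation in charts, is injective because translation by \<open>inv h\<close> undoes it.  Hence \<open>B\<close> embeds
  the kernel of \<open>D\<close> into that of \<open>D'\<close>.  Since \<open>g1\<close> and \<open>g2\<close> are arbitrary in the chart, the
  orbit map has constant rank there.\<close>

lemma dim_kernel_orbit_map_le:
  assumes act: "smooth_action G L M \<alpha>" and y: "y \<in> mfd_space M"
    and U: "(U, \<phi>) \<in> mfd_atlas L" and V: "(V, \<psi>) \<in> mfd_atlas M"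
    and g1: "g1 \<in> U" "\<alpha> g1 y \<in> V" and g2: "g2 \<in> U" "\<alpha> g2 y \<in> V"
    and D: "((\<psi> \<circ> (\<lambda>g. \<alpha> g y) \<circ> inv_into U \<phi>) has_derivative D)
      (at (\<phi> g1) within \<phi> ` (U \<inter> (\<lambda>g. \<alpha> g y) -` V))"
    and D': "((\<psi> \<circ> (\<lambda>g. \<alpha> g y) \<circ> inv_into U \<phi>) has_derivative D')
      (at (\<phi> g2) within \<phi> ` (U \<inter> (\<lambda>g. \<alpha> g y) -` V))"
  shows "dim {v \<in> mfd_model L. D v = 0} \<le> dim {v \<in> mfd_model L. D' v = 0}"
proof -
  note lie = smooth_action_lie_group[OF act]
  note L = lie_group_smooth_manifold[OF lie]
  note M = smooth_action_smooth_manifold[OF act]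
  note ga = smooth_action_group_action[OF act]
  interpret group G using lie by (rule lie_group_group)
  note chU = smooth_manifold_chart[OF L U] and chV = smooth_manifold_chart[OF M V]
  have UG: "U \<subseteq> carrier G"
    using mfd_chart_subset[OF chU] lie_group_space[OF lie] by simp
  have invU: "inv_into U \<phi> (\<phi> g) = g" if "g \<in> U" for g
    using that mfd_chart_inj_on[OF chU] by simp
  have invV: "inv_into V \<psi> (\<psi> x) = x" if "x \<in> V" for x
    using that mfd_chart_inj_on[OF chV] by simp
  let ?E = "mfd_model L"
  have E: "subspace ?E"
    using L by (simp add: smooth_manifold_def)
  have phiE: "\<phi> g \<in> ?E" if "g \<in> U" for g
    using chU that unfolding mfd_chart_def by (auto dest: openin_imp_subset)
  obtain p where p: "linear p" "range p \<subseteq> ?E" "\<And>x. x \<in> ?E \<Longrightarrow> p x = x"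
    using subspace_projection[OF E] by blast
  let ?f = "\<lambda>g. \<alpha> g y"
  let ?F = "\<psi> \<circ> ?f \<circ> inv_into U \<phi>"
  let ?A = "\<phi> ` (U \<inter> ?f -` V)"
  define h where "h = g2 \<otimes>\<^bsub>G\<^esub> inv\<^bsub>G\<^esub> g1"
  have G: "g1 \<in> carrier G" "g2 \<in> carrier G" "h \<in> carrier G" "inv\<^bsub>G\<^esub> h \<in> carrier G"
    using g1 g2 UG by (auto simp: h_def)
  have hg1: "h \<otimes>\<^bsub>G\<^esub> g1 = g2"
    using G by (simp add: h_def m_assoc)
  have hinv: "inv\<^bsub>G\<^esub> h \<otimes>\<^bsub>G\<^esub> (h \<otimes>\<^bsub>G\<^esub> g) = g" if "g \<in> carrier G" for g
    using that G by (simp flip: m_assoc)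
  have fh: "?f (h \<otimes>\<^bsub>G\<^esub> g) = \<alpha> h (?f g)" if "g \<in> carrier G" for g
    using group_action.composition_rule[OF ga y G(3) that] .
  let ?lt = "\<lambda>g. h \<otimes>\<^bsub>G\<^esub> g" and ?li = "\<lambda>g. inv\<^bsub>G\<^esub> h \<otimes>\<^bsub>G\<^esub> g"
  let ?T = "\<phi> \<circ> ?lt \<circ> inv_into U \<phi>" and ?S = "\<phi> \<circ> ?li \<circ> inv_into U \<phi>"
    and ?R = "\<psi> \<circ> \<alpha> h \<circ> inv_into V \<psi>"
  \<comment> \<open>A neighbourhood of \<open>g1\<close> on which all the compositions below stay inside the charts.\<close>
  define U0 where "U0 = U \<inter> {g \<in> mfd_space L. h \<otimes>\<^bsub>G\<^esub> g \<in> U} \<inter> {g \<in> mfd_space L. ?f g \<in> V}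
    \<inter> {g \<in> mfd_space L. ?f (h \<otimes>\<^bsub>G\<^esub> g) \<in> V}"
  have sf: "smooth_map L M ?f"
    using act y by (rule smooth_map_orbit_map)
  have st: "smooth_map L L ?lt"
    using lie G(3) by (rule smooth_map_left_translation)
  have oU: "openin (mfd_top L) U" and oV: "openin (mfd_top M) V"
    using chU chV by (auto simp: mfd_chart_def)
  have "continuous_map (mfd_top L) (mfd_top M) (\<lambda>g. ?f (h \<otimes>\<^bsub>G\<^esub> g))"
    using continuous_map_compose[OF smooth_map_continuous[OF st] smooth_map_continuous[OF sf]]
    by (simp add: o_def)
  then have "openin (mfd_top L) U0"
    unfolding U0_def using oU oV smooth_map_continuous[OF sf] smooth_map_continuous[OF st]
    by (intro openin_Int openin_continuous_map_preimage)
  then have A0: "openin (top_of_set ?E) (\<phi> ` U0)"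
    using mfd_chart_image_openin[OF chU] by (auto simp: U0_def)
  have U0: "g \<in> U" "g \<in> carrier G" "h \<otimes>\<^bsub>G\<^esub> g \<in> U" "?f g \<in> V" "\<alpha> h (?f g) \<in> V" if "g \<in> U0" for g
    using that UG fh[of g] by (auto simp: U0_def)
  have g1U0: "g1 \<in> U0"
    using g1 g2 G hg1 lie_group_space[OF lie] by (simp add: U0_def)
  let ?within = "at (\<phi> g1) within \<phi> ` U0"
  obtain B0 where "(?T has_derivative B0) (at (\<phi> g1) within \<phi> ` (U \<inter> ?lt -` U))"
    using smooth_on_has_derivative[OF smooth_map_in_charts[OF st U U]] g1U0 U0 by blast
  then have "(?T has_derivative B0) ?within"
    by (rule has_derivative_subset) (use U0 in auto)
  then have "((\<lambda>x. p (?T x)) has_derivative (\<lambda>v. p (B0 v))) ?within"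
    by (rule bounded_linear.has_derivative[OF iffD1[OF linear_conv_bounded_linear p(1)]])
  \<comment> \<open>Projecting ensures that the derivative maps the model space into itself.\<close>
  then have B: "(?T has_derivative (\<lambda>v. p (B0 v))) ?within"
    by (rule has_derivative_transform[rotated 2]) (use g1U0 U0 p(3) phiE invU in auto)
  let ?B = "\<lambda>v. p (B0 v)"
  have "\<phi> g2 \<in> \<phi> ` (U \<inter> ?li -` U)"
    using g1(1) g2(1) hinv[OF G(1)] hg1 by simp
  then obtain C where "(?S has_derivative C) (at (\<phi> g2) within \<phi> ` (U \<inter> ?li -` U))"
    by (rule smooth_on_has_derivative[OF smooth_map_in_charts[OF smooth_map_left_translation[OF lie G(4)] U U]])
  moreover have Tg1: "?T (\<phi> g1) = \<phi> g2"
    using g1(1) invU hg1 by simp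
  moreover have "?T ` \<phi> ` U0 \<subseteq> \<phi> ` (U \<inter> ?li -` U)"
  proof clarify
    fix g assume "g \<in> U0"
    then show "?T (\<phi> g) \<in> \<phi> ` (U \<inter> ?li -` U)"
      using invU[OF U0(1)] U0(1,3) hinv[OF U0(2)] by simp
  qed
  ultimately have C: "(?S has_derivative C) (at (?T (\<phi> g1)) within ?T ` \<phi> ` U0)"
    using has_derivative_subset by metis
  obtain Q where "(?R has_derivative Q) (at (\<psi> (?f g1)) within \<psi> ` (V \<inter> \<alpha> h -` V))"
    using smooth_on_has_derivative[OF smooth_map_in_charts[OF smooth_map_acting[OF act G(3)] V V]]
      g1U0 U0 by blast
  moreover have "?F (\<phi> g1) = \<psi> (?f g1)"
    using g1(1) invU by simp
  moreover have "?F ` \<phi> ` U0 \<subseteq> \<psi> ` (V \<inter> \<alpha> h -` V)"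
  proof clarify
    fix g assume "g \<in> U0"
    then show "?F (\<phi> g) \<in> \<psi> ` (V \<inter> \<alpha> h -` V)"
      using invU[OF U0(1)] U0(4,5) by simp
  qed
  ultimately have Q: "(?R has_derivative Q) (at (?F (\<phi> g1)) within ?F ` \<phi> ` U0)"
    using has_derivative_subset by metis
  have DF: "(?F has_derivative D) ?within"
    using D by (rule has_derivative_subset) (use U0 in auto)
  have DF': "(?F has_derivative D') (at (?T (\<phi> g1)) within ?T ` \<phi> ` U0)"
  proof -
    have "?T ` \<phi> ` U0 \<subseteq> ?A"
    proof clarify
      fix g assume "g \<in> U0"
      then show "?T (\<phi> g) \<in> ?A"
        using invU[OF U0(1)] U0(3,5) fh[OF U0(2)] by simp
    qed
    then show ?thesis
      unfolding Tg1 by (rule has_derivative_subset[OF D'])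
  qed
  have d1: "(?F \<circ> ?T has_derivative D' \<circ> ?B) ?within"
    using B DF' by (rule diff_chain_within)
  have "(?R \<circ> ?F has_derivative Q \<circ> D) ?within"
    using DF Q by (rule diff_chain_within)
  then have d2: "(?F \<circ> ?T has_derivative Q \<circ> D) ?within"
    by (rule has_derivative_transform[rotated 2]) (use g1U0 U0 fh invU invV in auto)
  note intertwine = has_derivative_unique_on_subspace[OF E A0 imageI[OF g1U0] d1 d2]
  have e1: "(?S \<circ> ?T has_derivative C \<circ> ?B) ?within"
    using B C by (rule diff_chain_within)
  have e2: "(?S \<circ> ?T has_derivative (\<lambda>v. v)) ?within"
    by (rule has_derivative_transform[OF _ _ has_derivative_ident]) (use g1U0 U0 hinv invU in auto)
  note left_inv = has_derivative_unique_on_subspace[OF E A0 imageI[OF g1U0] e1 e2]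
  have linB: "linear ?B" and linQ: "linear Q" and linD: "linear D"
    using B Q DF has_derivative_linear by blast+
  let ?K = "{v \<in> ?E. D v = 0}" and ?K' = "{v \<in> ?E. D' v = 0}"
  have "?K = ?E \<inter> {v. D v = 0}"
    by auto
  then have "subspace ?K"
    using E linear_subspace_kernel[OF linD] subspace_inter by metis
  moreover have "inj_on ?B ?K"
    using left_inv by (intro inj_on_inverseI[where g=C]) auto
  ultimately have "dim ?K = dim (?B ` ?K)"
    using dim_image_eq[OF linB, of ?K] span_eq_iff[of ?K] by metis
  also have "\<dots> \<le> dim ?K'"
    using intertwine linear_0[OF linQ] p(2) by (intro dim_subset) auto
  finally show ?thesis .
qed

text \<open>By equivariance the kernel has the same dimension throughout a chart, and an injective map with
  this property has injective derivative.\<close>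

lemma immersion_orbit_map:
  assumes act: "smooth_action G L M \<alpha>" and y: "y \<in> mfd_space M"
    and free: "stabilizer G \<alpha> y = {\<one>\<^bsub>G\<^esub>}"
  shows "immersion L M (\<lambda>g. \<alpha> g y)"
proof -
  note lie = smooth_action_lie_group[OF act]
  note L = lie_group_smooth_manifold[OF lie]
  note M = smooth_action_smooth_manifold[OF act]
  let ?f = "\<lambda>g. \<alpha> g y" and ?E = "mfd_model L"
  have sf: "smooth_map L M ?f"
    using act y by (rule smooth_map_orbit_map)
  have injf: "inj_on ?f (mfd_space L)"
    using inj_on_orbit_map[OF smooth_action_group_action[OF act] y free] lie_group_space[OF lie] by simp
  have E: "subspace ?E"
    using L by (simp add: smooth_manifold_def)
  obtain p where p: "linear p" "range p \<subseteq> ?E" "\<And>x. x \<in> ?E \<Longrightarrow> p x = x"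
    using subspace_projection[OF E] by blast
  have blp: "bounded_linear p"
    using p(1) linear_conv_bounded_linear by blast
  have "\<exists>D. ((\<psi> \<circ> ?f \<circ> inv_into U \<phi>) has_derivative D) (at (\<phi> g) within \<phi> ` (U \<inter> ?f -` V)) \<and>
      inj_on D ?E"
    if U: "(U, \<phi>) \<in> mfd_atlas L" and V: "(V, \<psi>) \<in> mfd_atlas M" and g: "g \<in> U \<inter> ?f -` V"
    for U \<phi> V \<psi> g
  proof -
    note chU = smooth_manifold_chart[OF L U] and chV = smooth_manifold_chart[OF M V]
    let ?F = "\<psi> \<circ> ?f \<circ> inv_into U \<phi>" and ?A = "\<phi> ` (U \<inter> ?f -` V)" and ?a = "\<phi> g"
    have a: "?a \<in> ?A"
      using g by blast
    obtain S k where k: "open S" "?a \<in> S" "\<forall>j. k_times_cont_diff_on j S k" "\<forall>x\<in>?A \<inter> S. ?F x = k x"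
      using smooth_map_in_charts[OF sf U V] a by (rule smooth_onE) blast
    define D where "D x = frechet_derivative k (at x)" for x
    have kD: "(k has_derivative D x) (at x)" if "x \<in> S" for x
      using k_times_cont_diff_on_has_derivative[of 0 S k x] k(3) that unfolding D_def by blast
    have FD: "(?F has_derivative D x) (at x within ?A)" if "x \<in> ?A" "x \<in> S" for x
    proof (rule has_derivative_transform_eventually)
      show "(k has_derivative D x) (at x within ?A)"
        using kD[OF that(2)] by (rule has_derivative_at_withinI)
      show "\<forall>\<^sub>F x in at x within ?A. k x = ?F x"
        using k(1,4) that(2) unfolding eventually_at_topological by (intro exI[of _ S]) auto
      show "k x = ?F x"
        using k(4) that by simp
    qed (rule that)
    have "U \<inter> ?f -` V = U \<inter> {g \<in> mfd_space L. ?f g \<in> V}"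
      using mfd_chart_subset[OF chU] by auto
    moreover have "openin (mfd_top L) (U \<inter> {g \<in> mfd_space L. ?f g \<in> V})"
      using chU chV smooth_map_continuous[OF sf]
      by (intro openin_Int openin_continuous_map_preimage) (auto simp: mfd_chart_def)
    ultimately have "openin (top_of_set ?E) ?A"
      using mfd_chart_image_openin[OF chU] by (metis Int_lower1)
    then obtain T where T: "open T" "?A = ?E \<inter> T"
      by (auto simp: openin_open)
    have aE: "?a \<in> ?E"
      using a T by auto
    define W where "W = p -` (T \<inter> S)"
    have pW: "p x \<in> ?A" "p x \<in> S" if "x \<in> W" for x
      using that p(2) T(2) by (auto simp: W_def)
    have W: "open W" "?a \<in> W"
    proof -
      show "open W"
        unfolding W_def using T(1) k(1) linear_continuous_on[OF blp, of UNIV]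
        by (simp add: continuous_on_open_vimage open_Int)
      show "?a \<in> W"
        using a k(2) T(2) p(3)[OF aE] by (simp add: W_def)
    qed
    \<comment> \<open>Adding the coordinate transversal to the model space makes the coordinate map injective on
      an open set without changing the kernel of its derivative.\<close>
    define H where "H x = (k (p x), x - p x)" for x
    define H' where "H' x = Blinfun (\<lambda>v. (D (p x) (p v), v - p v))" for x
    have H: "(H has_derivative (\<lambda>v. (D (p x) (p v), v - p v))) (at x)" if "x \<in> W" for x
    proof -
      have pd: "(p has_derivative p) (at x)"
        using blp by (rule bounded_linear_imp_has_derivative)
      show ?thesis
        unfolding H_def
        by (rule has_derivative_Pair[OF has_derivative_compose[OF pd kD[OF pW(2)[OF that]]]
              has_derivative_diff[OF has_derivative_ident pd]])
    qed
    have H'_apply: "H' x v = (D (p x) (p v), v - p v)" if "x \<in> W" for x v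
      unfolding H'_def by (subst bounded_linear_Blinfun_apply) (rule has_derivative_bounded_linear[OF H[OF that]], rule refl)
    have "inj_on H W"
    proof (rule inj_onI)
      fix x x' assume x: "x \<in> W" "x' \<in> W" "H x = H x'"
      obtain u u' where u: "u \<in> U" "p x = \<phi> u" "u' \<in> U" "p x' = \<phi> u'" "?f u \<in> V" "?f u' \<in> V"
        using pW(1)[OF x(1)] pW(1)[OF x(2)] by blast
      have "?F (p x) = ?F (p x')"
        using x(3) k(4) pW[OF x(1)] pW[OF x(2)] by (simp add: H_def)
      then have "\<psi> (?f u) = \<psi> (?f u')"
        using u mfd_chart_inj_on[OF chU] by simp
      then have "?f u = ?f u'"
        using u mfd_chart_inj_on[OF chV] by (simp add: inj_on_eq_iff)
      then have "u = u'"
        using u mfd_chart_subset[OF chU] by (intro inj_onD[OF injf]) auto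
      then show "x = x'"
        using x(3) u by (simp add: H_def)
    qed
    moreover have "(H has_derivative H' x) (at x)" if "x \<in> W" for x
    proof -
      have "blinfun_apply (H' x) = (\<lambda>v. (D (p x) (p v), v - p v))"
        using H'_apply[OF that] by blast
      then show ?thesis
        using H[OF that] by simp
    qed
    moreover have "continuous_on W H'"
    proof (rule continuous_on_blinfun_componentwise)
      fix i
      have "k_times_cont_diff_on (Suc 0) S k"
        using k(3) by blast
      then have "continuous_on S (\<lambda>x. D x (p i))"
        by (simp add: D_def)
      then have "continuous_on W (\<lambda>x. D (p x) (p i))"
        by (rule continuous_on_compose2[OF _ linear_continuous_on[OF blp]]) (use pW(2) in blast)
      then have "continuous_on W (\<lambda>x. (D (p x) (p i), i - p i))"
        by (intro continuous_on_Pair continuous_on_const)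
      then show "continuous_on W (\<lambda>x. H' x i)"
        by (rule continuous_on_eq) (simp add: H'_apply)
    qed
    moreover have ker: "{v. H' x v = 0} = {v \<in> ?E. D (p x) v = 0}" if "x \<in> W" for x
    proof -
      have "H' x v = 0 \<longleftrightarrow> v \<in> ?E \<and> D (p x) v = 0" for v
        using p(2) p(3)[of v] unfolding H'_apply[OF that] by (auto simp: zero_prod_def)
      then show ?thesis
        by blast
    qed
    have "dim {v. H' ?a v = 0} \<le> dim {v. H' x v = 0}" if x: "x \<in> W" for x
    proof -
      obtain u where u: "u \<in> U" "?f u \<in> V" "p x = \<phi> u"
        using pW(1)[OF x] by blast
      have "(?F has_derivative D (\<phi> u)) (at (\<phi> u) within ?A)"
        using FD[OF pW[OF x]] u(3) by simp
      then have "dim {v \<in> ?E. D ?a v = 0} \<le> dim {v \<in> ?E. D (\<phi> u) v = 0}"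
        using g by (intro dim_kernel_orbit_map_le[OF act y U V _ _ u(1,2) FD[OF a k(2)]]) auto
      then show ?thesis
        using ker[OF x] ker[OF W(2)] u(3) p(3)[OF aE] by simp
    qed
    ultimately have "H' ?a v = 0 \<Longrightarrow> v = 0" for v
      using injective_imp_injective_derivative[OF W, of H H'] by blast
    then have "v = 0" if "v \<in> ?E" "D ?a v = 0" for v
      using ker[OF W(2)] p(3)[OF aE] that by auto
    then have "inj_on (D ?a) ?E"
      using linear_inj_on_iff_eq_0[OF has_derivative_linear[OF kD[OF k(2)]] E] by blast
    then show ?thesis
      using FD[OF a k(2)] by blast
  qed
  then show ?thesis
    unfolding immersion_def using sf by blast
qed

lemma homeomorphic_map_orbit_map:
  assumes act: "smooth_action G L M \<alpha>" and y: "y \<in> mfd_space M"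
    and free: "stabilizer G \<alpha> y = {\<one>\<^bsub>G\<^esub>}"
  shows "homeomorphic_map (mfd_top L) (orbit_topology L \<alpha> y) (\<lambda>g. \<alpha> g y)"
  unfolding homeomorphic_map_def orbit_topology_def
  using quotient_map_final_topology inj_on_orbit_map[OF smooth_action_group_action[OF act] y free]
    lie_group_space[OF smooth_action_lie_group[OF act]]
  by auto

text \<open>The dimension is that of the group, whatever the point.  Since the lifted action is again a smooth
  action with trivial stabilizers, this applies to its orbits without comparing them to the orbits
  below.\<close>

lemma has_orbit_dim_free:
  assumes act: "smooth_action G L M \<alpha>" and y: "y \<in> mfd_space M"
    and free: "stabilizer G \<alpha> y = {\<one>\<^bsub>G\<^esub>}"
  shows "has_orbit_dim L M \<alpha> y (mfd_dim L)"
proof -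
  note L = lie_group_smooth_manifold[OF smooth_action_lie_group[OF act]]
  note h = homeomorphic_map_orbit_map[OF assms]
  let ?S = "transport_mfd L (orbit_topology L \<alpha> y) (\<lambda>g. \<alpha> g y)"
  have "smooth_manifold ?S" "immersion ?S M (\<lambda>y. y)"
    using smooth_manifold_transport[OF L h] immersion_transport[OF L h immersion_orbit_map[OF assms]] .
  moreover have "mfd_top ?S = orbit_topology L \<alpha> y" "mfd_dim ?S = mfd_dim L"
    by (simp_all add: transport_mfd_def mfd_dim_def)
  ultimately show ?thesis
    unfolding has_orbit_dim_def by blast
qed

section \<open>Return times of free and regular actions\<close>

lemma openin_prod_topology_nhd:
  assumes "openin (prod_topology X Y) S" "(x, y) \<in> S"
  obtains U V where "openin X U" "openin Y V" "x \<in> U" "y \<in> V" "U \<times> V \<subseteq> S"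
  using assms unfolding openin_prod_topology_alt by metis

text \<open>Manifolds are locally compact: a small closed ball in a chart is compact, hence closed, so it
  contains the frontier of the corresponding open ball.\<close>

lemma manifold_nhd_compact_frontier:
  assumes L: "smooth_manifold L" and B: "openin (mfd_top L) B" "x \<in> B"
  obtains B' where "openin (mfd_top L) B'" "x \<in> B'" "B' \<subseteq> B"
    "compactin (mfd_top L) (mfd_top L frontier_of B')"
proof -
  let ?X = "mfd_top L" and ?E = "mfd_model L"
  have "x \<in> topspace ?X"
    using openin_subset[OF B(1)] B(2) by auto
  then obtain U \<phi> where U: "(U, \<phi>) \<in> mfd_atlas L" "x \<in> U"
    by (rule smooth_manifold_covered[OF L])
  note ch = smooth_manifold_chart[OF L U(1)]
  obtain k where k: "homeomorphic_maps (subtopology ?X U) (top_of_set (\<phi> ` U)) \<phi> k"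
    using ch unfolding mfd_chart_def homeomorphic_map_maps by blast
  have UX: "U \<subseteq> topspace ?X" and oU: "openin ?X U"
    using mfd_chart_subset[OF ch] ch by (auto simp: mfd_chart_def)
  have kphi: "k (\<phi> u) = u" if "u \<in> U" for u
    using k that UX unfolding homeomorphic_maps_def by (simp add: subset_iff)
  have "openin (top_of_set ?E) (\<phi> ` (U \<inter> B))"
    using oU B(1) by (intro mfd_chart_image_openin[OF ch]) auto
  then obtain T where T: "open T" "\<phi> ` (U \<inter> B) = ?E \<inter> T"
    by (auto simp: openin_open)
  have "\<phi> x \<in> ?E \<inter> T"
    using U(2) B(2) unfolding T(2)[symmetric] by blast
  then obtain r where r: "r > 0" "cball (\<phi> x) r \<subseteq> T" and xE: "\<phi> x \<in> ?E"
    using T(1) open_contains_cball by blast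
  let ?C = "cball (\<phi> x) r \<inter> ?E" and ?D = "ball (\<phi> x) r \<inter> ?E"
  have CW: "?C \<subseteq> \<phi> ` (U \<inter> B)" and DC: "?D \<subseteq> ?C"
    using r(2) T(2) by auto
  have kB: "k ` ?C \<subseteq> U \<inter> B"
    using CW kphi by fastforce
  have contk: "continuous_map (top_of_set (\<phi> ` U)) (subtopology ?X U) k"
    using k by (simp add: homeomorphic_maps_def)
  have "compact ?C"
    using L by (intro compact_Int_closed compact_cball closed_subspace) (simp add: smooth_manifold_def)
  then have "compactin (top_of_set (\<phi> ` U)) ?C"
    using CW by (auto simp: compactin_subtopology)
  then have "compactin (subtopology ?X U) (k ` ?C)"
    using contk by (rule image_compactin)
  then have cK: "compactin ?X (k ` ?C)"
    by (simp add: compactin_subtopology)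
  define B' where "B' = k ` ?D"
  have "openin (top_of_set (\<phi> ` U)) ?D"
  proof -
    have "\<phi> ` U \<subseteq> ?E"
      using ch unfolding mfd_chart_def by (blast dest: openin_imp_subset)
    then have "?D = \<phi> ` U \<inter> ball (\<phi> x) r"
      using DC CW by blast
    then show ?thesis
      by (simp add: openin_open_Int)
  qed
  moreover have "open_map (top_of_set (\<phi> ` U)) (subtopology ?X U) k"
    using k by (intro homeomorphic_imp_open_map) (simp add: homeomorphic_maps_map)
  ultimately have "openin (subtopology ?X U) B'"
    unfolding B'_def by (simp add: open_map_def)
  then have oB': "openin ?X B'"
    using oU by (rule openin_trans_full)
  have "closedin ?X (k ` ?C)"
    using cK L by (intro compactin_imp_closedin) (auto simp: smooth_manifold_def)
  then have "?X closure_of B' \<subseteq> k ` ?C"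
    unfolding B'_def using DC by (intro closure_of_minimal image_mono)
  then have "?X frontier_of B' \<subseteq> k ` ?C"
    by (auto simp: frontier_of_def)
  then have "compactin ?X (?X frontier_of B')"
    by (rule closed_compactin[OF cK _ closedin_frontier_of])
  moreover have "x \<in> B'"
    unfolding B'_def using r(1) xE kphi[OF U(2)] by (intro image_eqI[of _ _ "\<phi> x"]) auto
  moreover have "B' \<subseteq> B"
    unfolding B'_def using kB DC by blast
  ultimately show thesis
    using that oB' by blast
qed

text \<open>With trivial stabilizer the orbit topology is a copy of the group, so connectedness of a piece of
  the orbit is connectedness of the set of group elements reaching it.\<close>

lemma connectedin_return_times:
  assumes act: "smooth_action G L M \<alpha>" and z: "z \<in> mfd_space M"
    and free: "stabilizer G \<alpha> z = {\<one>\<^bsub>G\<^esub>}"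
    and conn: "connectedin (orbit_topology L \<alpha> z) (N \<inter> orbit G \<alpha> z)"
  shows "connectedin (mfd_top L) {g \<in> carrier G. \<alpha> g z \<in> N}"
proof -
  have LG: "mfd_space L = carrier G"
    using lie_group_space[OF smooth_action_lie_group[OF act]] .
  have "(\<lambda>g. \<alpha> g z) ` {g \<in> carrier G. \<alpha> g z \<in> N} = N \<inter> orbit G \<alpha> z"
    by (auto simp: orbit_def)
  then show ?thesis
    using homeomorphic_map_connectedness[OF homeomorphic_map_orbit_map[OF act z free],
        of "{g \<in> carrier G. \<alpha> g z \<in> N}"] conn LG by auto
qed

text \<open>Freeness alone does not prevent an orbit from coming back near \<open>y\<close> after a long time; regularity
  does.  Choose a neighbourhood \<open>B'\<close> of the identity in \<open>B\<close> with compact frontier.  As no element of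
  the frontier fixes \<open>y\<close>, compactness provides a neighbourhood \<open>R0\<close> of \<open>y\<close> which no element of
  the frontier maps to a set meeting it.  For \<open>z\<close> in a regular neighbourhood inside \<open>R0\<close>, the set of
  \<open>g\<close> with \<open>\<alpha> g z\<close> in that neighbourhood is connected, contains the identity and misses the frontier
  of \<open>B'\<close>, so it lies in \<open>B'\<close>.\<close>

lemma small_return_times:
  assumes act: "smooth_action G L M \<alpha>"
    and W: "openin (mfd_top M) W" "y \<in> W"
    and free: "\<And>z. z \<in> W \<Longrightarrow> stabilizer G \<alpha> z = {\<one>\<^bsub>G\<^esub>}"
    and reg: "\<And>W. openin (mfd_top M) W \<Longrightarrow> y \<in> W \<Longrightarrow> \<exists>N. openin (mfd_top M) N \<and> y \<in> N \<and> N \<subseteq> W \<and>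
      (\<forall>z\<in>mfd_space M. connectedin (orbit_topology L \<alpha> z) (N \<inter> orbit G \<alpha> z))"
    and B: "openin (mfd_top L) B" "\<one>\<^bsub>G\<^esub> \<in> B"
  obtains N where "openin (mfd_top M) N" "y \<in> N" "N \<subseteq> W"
    "\<forall>z\<in>mfd_space M. connectedin (orbit_topology L \<alpha> z) (N \<inter> orbit G \<alpha> z)"
    "\<forall>g\<in>carrier G. \<forall>z\<in>N. \<alpha> g z \<in> N \<longrightarrow> g \<in> B"
proof -
  note lie = smooth_action_lie_group[OF act]
  note L = lie_group_smooth_manifold[OF lie]
  note M = smooth_action_smooth_manifold[OF act]
  note ga = smooth_action_group_action[OF act]
  let ?X = "mfd_top L" and ?Y = "mfd_top M"
  have LG: "mfd_space L = carrier G"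
    using lie by (rule lie_group_space)
  have yM: "y \<in> mfd_space M"
    using openin_subset[OF W(1)] W(2) by auto
  obtain B' where B': "openin ?X B'" "\<one>\<^bsub>G\<^esub> \<in> B'" "B' \<subseteq> B" "compactin ?X (?X frontier_of B')"
    using manifold_nhd_compact_frontier[OF L B] by blast
  let ?K = "?X frontier_of B'"
  define \<V> where "\<V> = {V. openin ?X V \<and> (\<exists>R. openin ?Y R \<and> y \<in> R \<and> (\<forall>g\<in>V. \<forall>z\<in>R. \<alpha> g z \<notin> R))}"
  have "\<exists>V\<in>\<V>. k \<in> V" if k: "k \<in> ?K" for k
  proof -
    have kG: "k \<in> carrier G"
      using k frontier_of_subset_topspace[of ?X B'] LG by blast
    have "k \<notin> B'"
      using k B'(1) by (auto simp: frontier_of_def interior_of_openin)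
    then have "k \<notin> stabilizer G \<alpha> y"
      using free[OF W(2)] B'(2) by auto
    then have "\<alpha> k y \<noteq> y"
      using kG by (simp add: stabilizer_def)
    moreover have "\<alpha> k y \<in> topspace ?Y"
      using group_action_closed[OF ga kG yM] .
    ultimately obtain P Q where PQ: "openin ?Y P" "openin ?Y Q" "\<alpha> k y \<in> P" "y \<in> Q" "disjnt P Q"
      using M yM unfolding smooth_manifold_def Hausdorff_space_def by blast
    let ?Z = "{w \<in> topspace (prod_topology ?X ?Y). (case w of (g, z) \<Rightarrow> \<alpha> g z) \<in> P}"
    have "openin (prod_topology ?X ?Y) ?Z"
      using smooth_map_continuous[OF smooth_action_smooth_map[OF act]] PQ(1)
      unfolding mfd_top_prod by (rule openin_continuous_map_preimage)
    moreover have "(k, y) \<in> ?Z"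
      using kG yM PQ(3) LG by simp
    ultimately obtain V R where VR: "openin ?X V" "openin ?Y R" "k \<in> V" "y \<in> R" "V \<times> R \<subseteq> ?Z"
      by (rule openin_prod_topology_nhd)
    have "\<alpha> g z \<notin> R \<inter> Q" if "g \<in> V" "z \<in> R \<inter> Q" for g z
      using that VR(5) PQ(5) by (auto simp: disjnt_iff)
    then have "V \<in> \<V>"
      unfolding \<V>_def using VR PQ(2,4) by (auto intro!: exI[of _ "R \<inter> Q"])
    then show ?thesis
      using VR(3) by blast
  qed
  then have "?K \<subseteq> \<Union>\<V>"
    by blast
  moreover have "\<And>V. V \<in> \<V> \<Longrightarrow> openin ?X V"
    by (simp add: \<V>_def)
  ultimately obtain \<F> where F: "finite \<F>" "\<F> \<subseteq> \<V>" "?K \<subseteq> \<Union>\<F>"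
    using compactinD[OF B'(4), of \<V>] by metis
  have "\<forall>V\<in>\<F>. \<exists>R. openin ?Y R \<and> y \<in> R \<and> (\<forall>g\<in>V. \<forall>z\<in>R. \<alpha> g z \<notin> R)"
    using F(2) unfolding \<V>_def by (simp add: subset_iff)
  from bchoice[OF this] obtain R where
    "\<forall>V\<in>\<F>. openin ?Y (R V) \<and> y \<in> R V \<and> (\<forall>g\<in>V. \<forall>z\<in>R V. \<alpha> g z \<notin> R V)" ..
  then have R: "\<And>V. V \<in> \<F> \<Longrightarrow> openin ?Y (R V)" "\<And>V. V \<in> \<F> \<Longrightarrow> y \<in> R V"
    "\<And>V g z. V \<in> \<F> \<Longrightarrow> g \<in> V \<Longrightarrow> z \<in> R V \<Longrightarrow> \<alpha> g z \<notin> R V"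
    by simp_all
  define R0 where "R0 = \<Inter>(insert W (R ` \<F>))"
  have "openin ?Y R0"
    unfolding R0_def using F(1) R(1) W(1) by (intro openin_Inter) auto
  moreover have "y \<in> R0"
    using R(2) W(2) by (simp add: R0_def)
  ultimately obtain N where N: "openin ?Y N" "y \<in> N" "N \<subseteq> R0"
    "\<forall>z\<in>mfd_space M. connectedin (orbit_topology L \<alpha> z) (N \<inter> orbit G \<alpha> z)"
    using reg by blast
  have NW: "N \<subseteq> W"
    using N(3) by (auto simp: R0_def)
  have ret: "g \<in> B" if g: "g \<in> carrier G" and z: "z \<in> N" and gz: "\<alpha> g z \<in> N" for g z
  proof -
    let ?C = "{g \<in> carrier G. \<alpha> g z \<in> N}"
    have zM: "z \<in> mfd_space M"
      using z openin_subset[OF N(1)] by auto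
    have "connectedin ?X ?C"
      using act zM free N(4) NW z by (intro connectedin_return_times) auto
    moreover have "?C \<inter> ?K = {}"
    proof (rule ccontr)
      assume "?C \<inter> ?K \<noteq> {}"
      then obtain k V where "\<alpha> k z \<in> N" "V \<in> \<F>" "k \<in> V"
        using F(3) by blast
      moreover from this have "N \<subseteq> R V"
        using N(3) by (auto simp: R0_def)
      ultimately show False
        using R(3)[of V k z] z by blast
    qed
    moreover have "\<one>\<^bsub>G\<^esub> \<in> ?C \<inter> B'"
      using B'(2) z group_action_one[OF ga zM] group.is_monoid[OF lie_group_group[OF lie]]
      by (simp add: monoid.one_closed)
    ultimately have "?C - B' = {}"
      using connectedin_Int_frontier_of[of ?X ?C B'] by blast
    then show "g \<in> B"
      using g gz B'(3) by blast
  qed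
  show thesis
    by (rule that[OF N(1,2) NW N(4)]) (intro ballI impI ret)
qed

section \<open>Regularity of the lifted action\<close>

lemma stabilizer_lift_action:
  assumes act: "smooth_action G L M \<alpha>" and mul: "smooth_multiplier G L M \<alpha> \<mu>"
    and x: "x \<in> mfd_space M" "t \<noteq> 0" and free: "stabilizer G \<alpha> x = {\<one>\<^bsub>G\<^esub>}"
  shows "stabilizer G (lift_action M \<alpha> \<mu>) (x, t) = {\<one>\<^bsub>G\<^esub>}"
proof
  show "stabilizer G (lift_action M \<alpha> \<mu>) (x, t) \<subseteq> {\<one>\<^bsub>G\<^esub>}"
    unfolding free[symmetric] using x by (auto simp: stabilizer_def lift_action_apply)
  have "group G"
    using act by (rule smooth_action_group)
  moreover have "lift_action M \<alpha> \<mu> \<one>\<^bsub>G\<^esub> (x, t) = (x, t)"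
    using smooth_action_group_action[OF smooth_action_lift[OF act mul]] x
    by (intro group_action_one) (auto simp: mfd_space_lift)
  ultimately show "{\<one>\<^bsub>G\<^esub>} \<subseteq> stabilizer G (lift_action M \<alpha> \<mu>) (x, t)"
    by (simp add: stabilizer_def group.is_monoid monoid.one_closed)
qed

lemma stabilizer_trivial_translate:
  assumes act: "group_action G X \<alpha>" and z: "z \<in> X" and h: "h \<in> carrier G"
    and free: "stabilizer G \<alpha> (\<alpha> h z) = {\<one>\<^bsub>G\<^esub>}"
  shows "stabilizer G \<alpha> z = {\<one>\<^bsub>G\<^esub>}"
proof -
  interpret group_action G X \<alpha> by fact
  interpret group G using group_hom by (simp add: group_hom_def)
  have "k = \<one>\<^bsub>G\<^esub>" if k: "k \<in> carrier G" "\<alpha> k z = z" for k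
  proof -
    have "\<alpha> (h \<otimes>\<^bsub>G\<^esub> k \<otimes>\<^bsub>G\<^esub> inv\<^bsub>G\<^esub> h) (\<alpha> h z) = \<alpha> (h \<otimes>\<^bsub>G\<^esub> k \<otimes>\<^bsub>G\<^esub> inv\<^bsub>G\<^esub> h \<otimes>\<^bsub>G\<^esub> h) z"
      using h k(1) z composition_rule[OF z, of "h \<otimes>\<^bsub>G\<^esub> k \<otimes>\<^bsub>G\<^esub> inv\<^bsub>G\<^esub> h" h] by simp
    also have "h \<otimes>\<^bsub>G\<^esub> k \<otimes>\<^bsub>G\<^esub> inv\<^bsub>G\<^esub> h \<otimes>\<^bsub>G\<^esub> h = h \<otimes>\<^bsub>G\<^esub> k"
      using h k(1) by (simp add: m_assoc)
    also have "\<alpha> (h \<otimes>\<^bsub>G\<^esub> k) z = \<alpha> h z"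
      using h k z by (simp add: composition_rule)
    finally have "h \<otimes>\<^bsub>G\<^esub> k \<otimes>\<^bsub>G\<^esub> inv\<^bsub>G\<^esub> h \<in> stabilizer G \<alpha> (\<alpha> h z)"
      using h k(1) by (simp add: stabilizer_def)
    then have "h \<otimes>\<^bsub>G\<^esub> k \<otimes>\<^bsub>G\<^esub> inv\<^bsub>G\<^esub> h = \<one>\<^bsub>G\<^esub>"
      using free by simp
    then have "h \<otimes>\<^bsub>G\<^esub> k = h"
      using h k(1) by (metis inv_solve_right l_one m_closed one_closed)
    then show ?thesis
      using h k(1) by simp
  qed
  then show ?thesis
    using group_action_one[OF act z] by (auto simp: stabilizer_def)
qed

text \<open>A product neighbourhood \<open>N \<times> J\<close> is in general not regular, since the fibre coordinate may leave \<open>J\<close>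
  and return while the base point stays in \<open>N\<close>.  Therefore \<open>N \<times> J\<close> is saturated: \<open>N'\<close> consists of
  all points above \<open>N\<close> whose orbit meets \<open>N \<times> J\<close>.  An orbit of the lifted action then meets \<open>N'\<close>
  either not at all or in everything that lies above \<open>N\<close>, and the latter is as connected as the
  part in \<open>N\<close> of the orbit below.  The saturation stays inside \<open>W\<close> because \<open>N\<close> has small return
  times: only group elements near the identity are used to get from \<open>N \<times> J\<close> to \<open>N'\<close>.\<close>

lemma lift_regular_neighbourhood:
  assumes act: "smooth_action G L M \<alpha>" and mul: "smooth_multiplier G L M \<alpha> \<mu>"
    and U: "openin (mfd_top M) U" "y \<in> U"
    and free: "\<And>z. z \<in> U \<Longrightarrow> stabilizer G \<alpha> z = {\<one>\<^bsub>G\<^esub>}"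
    and reg: "\<And>W. openin (mfd_top M) W \<Longrightarrow> y \<in> W \<Longrightarrow> \<exists>N. openin (mfd_top M) N \<and> y \<in> N \<and> N \<subseteq> W \<and>
      (\<forall>z\<in>mfd_space M. connectedin (orbit_topology L \<alpha> z) (N \<inter> orbit G \<alpha> z))"
    and W: "openin (mfd_top (lift_mfd M)) W" "(y, t) \<in> W"
  shows "\<exists>N. openin (mfd_top (lift_mfd M)) N \<and> (y, t) \<in> N \<and> N \<subseteq> W \<and>
    (\<forall>q\<in>mfd_space (lift_mfd M).
      connectedin (orbit_topology L (lift_action M \<alpha> \<mu>) q) (N \<inter> orbit G (lift_action M \<alpha> \<mu>) q))"
proof -
  let ?\<beta> = "lift_action M \<alpha> \<mu>" and ?M = "lift_mfd M" and ?X = "mfd_top L"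
  note lie = smooth_action_lie_group[OF act]
  note actl = smooth_action_lift[OF act mul]
  note ga = smooth_action_group_action[OF act] and gal = smooth_action_group_action[OF actl]
  interpret group G using act by (rule smooth_action_group)
  have LG: "mfd_space L = carrier G"
    using lie by (rule lie_group_space)
  have top: "mfd_top ?M = prod_topology (mfd_top M) (top_of_set (- {0}))"
    by (simp add: lift_mfd_def mfd_top_prod nonzero_reals_def)
  have p: "(y, t) \<in> mfd_space ?M"
    using W openin_subset by blast
  have fst_eq: "fst (?\<beta> g q) = \<alpha> g (fst q)" if "q \<in> mfd_space ?M" for g q
    using that by (cases q) (simp add: mfd_space_lift lift_action_apply)
  have comp: "?\<beta> (g \<otimes>\<^bsub>G\<^esub> h) q = ?\<beta> g (?\<beta> h q)"
    if "q \<in> mfd_space ?M" "g \<in> carrier G" "h \<in> carrier G" for g h q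
    using group_action.composition_rule[OF gal that] .
  \<comment> \<open>Elements near the identity keep points near \<open>(y, t)\<close> inside \<open>W\<close>.\<close>
  let ?Z = "{w \<in> topspace (prod_topology ?X (mfd_top ?M)). (case w of (g, q) \<Rightarrow> ?\<beta> g q) \<in> W}"
  have "openin (prod_topology ?X (mfd_top ?M)) ?Z"
    using smooth_map_continuous[OF smooth_action_smooth_map[OF actl]] W(1)
    unfolding mfd_top_prod by (rule openin_continuous_map_preimage)
  moreover have "(\<one>\<^bsub>G\<^esub>, (y, t)) \<in> ?Z"
    using p LG W(2) group_action_one[OF gal p] by simp
  ultimately obtain B \<Omega> where B: "openin ?X B" "\<one>\<^bsub>G\<^esub> \<in> B"
    and \<Omega>: "openin (mfd_top ?M) \<Omega>" "(y, t) \<in> \<Omega>" and BZ: "B \<times> \<Omega> \<subseteq> ?Z"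
    by (rule openin_prod_topology_nhd)
  obtain N1 J where N1: "openin (mfd_top M) N1" "y \<in> N1" and J: "openin (top_of_set (- {0})) J" "t \<in> J"
    and NJ: "N1 \<times> J \<subseteq> \<Omega>"
    using \<Omega> unfolding top by (rule openin_prod_topology_nhd)
  have UN: "openin (mfd_top M) (U \<inter> N1)" "y \<in> U \<inter> N1"
    using U N1 by auto
  obtain N where N: "openin (mfd_top M) N" "y \<in> N" "N \<subseteq> U \<inter> N1"
    and conn: "\<forall>z\<in>mfd_space M. connectedin (orbit_topology L \<alpha> z) (N \<inter> orbit G \<alpha> z)"
    and ret: "\<forall>g\<in>carrier G. \<forall>z\<in>N. \<alpha> g z \<in> N \<longrightarrow> g \<in> B"
    by (rule small_return_times[OF act UN _ reg B]) (simp add: free)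
  define N' where "N' = {q \<in> mfd_space ?M. fst q \<in> N \<and> (\<exists>g\<in>carrier G. ?\<beta> g q \<in> N \<times> J)}"
  have N'_eq: "N' = {q \<in> mfd_space ?M. fst q \<in> N} \<inter> (\<Union>g\<in>carrier G. {q \<in> mfd_space ?M. ?\<beta> g q \<in> N \<times> J})"
    unfolding N'_def by (intro equalityI subsetI; simp)
  have "openin (mfd_top ?M) N'"
    unfolding N'_eq
  proof (intro openin_Int openin_Union)
    show "openin (mfd_top ?M) {q \<in> mfd_space ?M. fst q \<in> N}"
      using N(1) unfolding top by (intro openin_continuous_map_preimage[OF continuous_map_fst])
    have "openin (mfd_top ?M) (N \<times> J)"
      using N(1) J(1) unfolding top by (simp add: openin_prod_Times_iff)
    then show "openin (mfd_top ?M) S"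
      if "S \<in> (\<lambda>g. {q \<in> mfd_space ?M. ?\<beta> g q \<in> N \<times> J}) ` carrier G" for S
      using that smooth_map_continuous[OF smooth_map_acting[OF actl]] openin_continuous_map_preimage by blast
  qed
  moreover have "(y, t) \<in> N'"
    unfolding N'_def using p N(2) J(2) group_action_one[OF gal p]
    by (intro CollectI conjI bexI[of _ "\<one>\<^bsub>G\<^esub>"]) simp_all
  moreover have "N' \<subseteq> W"
  proof
    fix q assume "q \<in> N'"
    then obtain g where q: "q \<in> mfd_space ?M" "fst q \<in> N" and g: "g \<in> carrier G" "?\<beta> g q \<in> N \<times> J"
      unfolding N'_def mem_Collect_eq by (elim conjE bexE)
    let ?r = "?\<beta> g q"
    have r: "?r \<in> mfd_space ?M"
      using group_action_closed[OF gal g(1) q(1)] .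
    have return: "?\<beta> (inv\<^bsub>G\<^esub> g) ?r = q"
      using comp[OF q(1), of "inv\<^bsub>G\<^esub> g" g] g(1) group_action_one[OF gal q(1)] by simp
    then have "\<alpha> (inv\<^bsub>G\<^esub> g) (fst ?r) \<in> N"
      using fst_eq[OF r, of "inv\<^bsub>G\<^esub> g"] q(2) by simp
    moreover have "fst ?r \<in> N"
      using g(2) by (simp add: mem_Times_iff)
    ultimately have "inv\<^bsub>G\<^esub> g \<in> B"
      using ret g(1) by blast
    moreover have "N \<times> J \<subseteq> \<Omega>"
      using N(3) NJ by blast
    then have "?r \<in> \<Omega>"
      using g(2) by (rule subsetD)
    ultimately have "(inv\<^bsub>G\<^esub> g, ?r) \<in> ?Z"
      using BZ by blast
    then show "q \<in> W"
      using return by simp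
  qed
  moreover have "connectedin (orbit_topology L ?\<beta> q) (N' \<inter> orbit G ?\<beta> q)" if q: "q \<in> mfd_space ?M" for q
  proof (cases "N' \<inter> orbit G ?\<beta> q = {}")
    case False
    then obtain r where "r \<in> N'" "r \<in> orbit G ?\<beta> q"
      by blast
    then obtain h where h: "h \<in> carrier G" "?\<beta> h q \<in> N'"
      unfolding orbit_def by blast
    then obtain g where g: "g \<in> carrier G" "?\<beta> g (?\<beta> h q) \<in> N \<times> J"
      unfolding N'_def mem_Collect_eq by (elim conjE bexE)
    have z: "fst q \<in> mfd_space M"
      using q by (auto simp: mfd_space_lift)
    have "\<alpha> h (fst q) \<in> N"
      using h(2) fst_eq[OF q] by (auto simp: N'_def)
    then have "stabilizer G \<alpha> (fst q) = {\<one>\<^bsub>G\<^esub>}"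
      using stabilizer_trivial_translate[OF ga z h(1)] free N(3) by blast
    then have "connectedin ?X {k \<in> carrier G. \<alpha> k (fst q) \<in> N}"
      using connectedin_return_times[OF act z] conn z by blast
    moreover have "continuous_map ?X (orbit_topology L ?\<beta> q) (\<lambda>k. ?\<beta> k q)"
      unfolding orbit_topology_def by (rule quotient_imp_continuous_map[OF quotient_map_final_topology])
    ultimately have c: "connectedin (orbit_topology L ?\<beta> q) ((\<lambda>k. ?\<beta> k q) ` {k \<in> carrier G. \<alpha> k (fst q) \<in> N})"
      by (rule connectedin_continuous_map_image[rotated])
    \<comment> \<open>Meeting the orbit once, \<open>N'\<close> contains all of its part above \<open>N\<close>.\<close>
    have "?\<beta> k q \<in> N'" if k: "k \<in> carrier G" "\<alpha> k (fst q) \<in> N" for k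
    proof -
      have kq: "?\<beta> k q \<in> mfd_space ?M"
        using group_action_closed[OF gal k(1) q] .
      have "?\<beta> (g \<otimes>\<^bsub>G\<^esub> h \<otimes>\<^bsub>G\<^esub> inv\<^bsub>G\<^esub> k) (?\<beta> k q) = ?\<beta> (g \<otimes>\<^bsub>G\<^esub> h \<otimes>\<^bsub>G\<^esub> inv\<^bsub>G\<^esub> k \<otimes>\<^bsub>G\<^esub> k) q"
        using comp[OF q, of "g \<otimes>\<^bsub>G\<^esub> h \<otimes>\<^bsub>G\<^esub> inv\<^bsub>G\<^esub> k" k] g(1) h(1) k(1) by simp
      also have "g \<otimes>\<^bsub>G\<^esub> h \<otimes>\<^bsub>G\<^esub> inv\<^bsub>G\<^esub> k \<otimes>\<^bsub>G\<^esub> k = g \<otimes>\<^bsub>G\<^esub> h"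
        using g(1) h(1) k(1) by (simp add: m_assoc)
      also have "?\<beta> (g \<otimes>\<^bsub>G\<^esub> h) q = ?\<beta> g (?\<beta> h q)"
        using comp[OF q g(1) h(1)] .
      finally have "?\<beta> (g \<otimes>\<^bsub>G\<^esub> h \<otimes>\<^bsub>G\<^esub> inv\<^bsub>G\<^esub> k) (?\<beta> k q) \<in> N \<times> J"
        using g(2) by simp
      moreover have "g \<otimes>\<^bsub>G\<^esub> h \<otimes>\<^bsub>G\<^esub> inv\<^bsub>G\<^esub> k \<in> carrier G"
        using g(1) h(1) k(1) by simp
      ultimately have "\<exists>g\<in>carrier G. ?\<beta> g (?\<beta> k q) \<in> N \<times> J"
        by (rule bexI)
      then show ?thesis
        unfolding N'_def using kq k(2) fst_eq[OF q] by simp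
    qed
    moreover have "\<alpha> k (fst q) \<in> N" if "?\<beta> k q \<in> N'" for k
      using that fst_eq[OF q] by (simp add: N'_def)
    ultimately have "N' \<inter> orbit G ?\<beta> q = (\<lambda>k. ?\<beta> k q) ` {k \<in> carrier G. \<alpha> k (fst q) \<in> N}"
      unfolding orbit_def by blast
    with c show ?thesis
      by simp
  qed simp
  ultimately show ?thesis
    by blast
qed

lemma free_and_regular_near_lift:
  assumes act: "smooth_action G L M \<alpha>" and mul: "smooth_multiplier G L M \<alpha> \<mu>"
    and x: "free_and_regular_near G L M \<alpha> x" and t: "t \<noteq> 0"
  shows "free_and_regular_near G L (lift_mfd M) (lift_action M \<alpha> \<mu>) (x, t)"
proof -
  let ?\<beta> = "lift_action M \<alpha> \<mu>" and ?M = "lift_mfd M"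
  note actl = smooth_action_lift[OF act mul]
  obtain U where U: "openin (mfd_top M) U" "x \<in> U" "free_on G \<alpha> U" "regular_on G L M \<alpha> U"
    using x unfolding free_and_regular_near_def by blast
  have UM: "U \<subseteq> mfd_space M"
    using U(1) by (rule openin_subset)
  have free: "stabilizer G \<alpha> z = {\<one>\<^bsub>G\<^esub>}" if "z \<in> U" for z
    using U(3) that by (simp add: free_on_def)
  have freel: "stabilizer G ?\<beta> p = {\<one>\<^bsub>G\<^esub>}" if "p \<in> U \<times> - {0}" for p
    using that stabilizer_lift_action[OF act mul] free UM by (cases p) auto
  have "openin (mfd_top ?M) (U \<times> - {0})"
    using U(1) by (auto simp: lift_mfd_def mfd_top_prod nonzero_reals_def openin_prod_Times_iff)
  moreover have "(x, t) \<in> U \<times> - {0}"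
    using U(2) t by simp
  moreover have "free_on G ?\<beta> (U \<times> - {0})"
    using freel by (simp add: free_on_def)
  moreover have "regular_on G L ?M ?\<beta> (U \<times> - {0})"
    unfolding regular_on_def
  proof (intro conjI exI[of _ "mfd_dim L"] ballI allI impI)
    show "has_orbit_dim L ?M ?\<beta> p (mfd_dim L)" if "p \<in> U \<times> - {0}" for p
      using that UM by (intro has_orbit_dim_free[OF actl _ freel]) (auto simp: mfd_space_lift)
  next
    fix p W assume p: "p \<in> U \<times> - {0}" and W: "openin (mfd_top ?M) W \<and> p \<in> W"
    obtain y s where y: "p = (y, s)" "y \<in> U"
      using p by blast
    have reg: "\<exists>N. openin (mfd_top M) N \<and> y \<in> N \<and> N \<subseteq> W \<and>
      (\<forall>z\<in>mfd_space M. connectedin (orbit_topology L \<alpha> z) (N \<inter> orbit G \<alpha> z))"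
      if "openin (mfd_top M) W" "y \<in> W" for W
      using U(4) y(2) that unfolding regular_on_def by blast
    show "\<exists>N. openin (mfd_top ?M) N \<and> p \<in> N \<and> N \<subseteq> W \<and>
        (\<forall>q\<in>mfd_space ?M. connectedin (orbit_topology L ?\<beta> q) (N \<inter> orbit G ?\<beta> q))"
      unfolding y(1) using W y(1) by (intro lift_regular_neighbourhood[OF act mul U(1) y(2) free reg]) auto
  qed
  ultimately show ?thesis
    unfolding free_and_regular_near_def by blast
qed

theorem theorem3:
  fixes G :: "('g, 'r) monoid_scheme"
    and L :: "('g, 'l::euclidean_space) mfd"
    and M :: "('m, 'e::euclidean_space) mfd"
    and \<alpha> :: "'g \<Rightarrow> 'm \<Rightarrow> 'm"
    and \<mu> :: "'g \<Rightarrow> 'm \<Rightarrow> real"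
    and m :: nat
  assumes "lie_group G L"
    and "smooth_manifold M" and "mfd_dim M = m"
    and "smooth_action G L M \<alpha>"
    and "smooth_multiplier G L M \<alpha> \<mu>"
  shows "smooth_action G L (lift_mfd M) (lift_action M \<alpha> \<mu>) \<and>
    equivariant_map G (mfd_space (lift_mfd M)) (lift_action M \<alpha> \<mu>) (mfd_space M) \<alpha> fst \<and>
    (\<forall>x\<in>mfd_space M. free_and_regular_near G L M \<alpha> x \<longrightarrow>
      (\<forall>p\<in>fst -` {x} \<inter> mfd_space (lift_mfd M).
        free_and_regular_near G L (lift_mfd M) (lift_action M \<alpha> \<mu>) p))"
proof (intro conjI ballI impI)
  show "smooth_action G L (lift_mfd M) (lift_action M \<alpha> \<mu>)"
    using assms(4,5) by (rule smooth_action_lift)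
  show "equivariant_map G (mfd_space (lift_mfd M)) (lift_action M \<alpha> \<mu>) (mfd_space M) \<alpha> fst"
    by (auto simp: equivariant_map_def mfd_space_lift lift_action_def)
  fix x p
  assume x: "free_and_regular_near G L M \<alpha> x" and p: "p \<in> fst -` {x} \<inter> mfd_space (lift_mfd M)"
  obtain t where "p = (x, t)" "t \<noteq> 0"
    using p by (cases p) (auto simp: mfd_space_lift)
  then show "free_and_regular_near G L (lift_mfd M) (lift_action M \<alpha> \<mu>) p"
    using free_and_regular_near_lift[OF assms(4,5) x] by simp
qed

end
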